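(* Let $K$ be an infinite field, $n\geq 2$, $S=K[x_1,\ldots,x_n]$. Let $1\leq i_1<i_2<\cdots<i_r\leq n$ be integers, $\alpha_1\geq\alpha_2\geq\cdots\geq\alpha_r$ positive integers, and $u=x_{i_1}^{\alpha_1}x_{i_2}^{\alpha_2}\cdots x_{i_r}^{\alpha_r}\in S$. Let $SBT(u)$ be the principal (SBT)-ideal generated by $u$. For $1\leq q\leq r$ define $$\chi_q=\alpha_1+\cdots+\alpha_{q-1}+(\alpha_q-1)i_q.$$ Then $\operatorname{reg}(SBT(u))=\left(\max_{1\leq q\leq r}\chi_q\right)+1$.
   Context: For a monomial $v$, $\nu_i(v)$ denotes the exponent of $x_i$ in $v$. A monomial ideal $I\subset S$ is of strong Borel type (SBT) if for every monomial $v\in I$ and all $1\leq j<i\leq n$ there exists an integer $0\leq t\leq\nu_i(v)$ such that $x_j^{t}v/x_i^{\nu_i(v)}\in I$. For a monomial $u$, the principal (SBT)-ideal $SBT(u)$ generated by $u$ is the smallest (with respect to inclusion) ideal of strong Borel type containing $u$. $\operatorname{reg}(I)=\max\{j-i:\beta_{ij}(I)\neq 0\}$ is the Castelnuovo-Mumford regularity. *)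

theory Defs
  imports "HOL-Library.Poly_Mapping" "HOL-Algebra.Ideal" "Jordan_Normal_Form.Matrix"
begin

text \<open>
  A monomial in the variables \<open>x\<^sub>0, x\<^sub>1, \<dots>\<close> is its exponent function, so
  \<open>Poly_Mapping.lookup v i\<close> is the exponent \<open>\<nu>\<^sub>i(v)\<close>, and products of monomials are sums of
  exponent functions. A polynomial is a finitely supported coefficient function on monomials.
\<close>

type_synonym monom = "nat \<Rightarrow>\<^sub>0 nat"
type_synonym 'k mpoly = "monom \<Rightarrow>\<^sub>0 'k"

definition monoms :: "nat \<Rightarrow> monom set" where
  "monoms n = {v. Poly_Mapping.keys v \<subseteq> {1..n}}"

definition monom_deg :: "monom \<Rightarrow> nat" where
  "monom_deg v = (\<Sum>i\<in>Poly_Mapping.keys v. Poly_Mapping.lookup v i)"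

definition mon_poly :: "monom \<Rightarrow> 'k::field mpoly" where
  "mon_poly v = Poly_Mapping.single v 1"

text \<open>The ring \<open>K[x\<^sub>1, \<dots>, x\<^sub>n]\<close>.\<close>

definition poly_ring :: "nat \<Rightarrow> 'k::field mpoly ring" where
  "poly_ring n = \<lparr>carrier = {f. Poly_Mapping.keys f \<subseteq> monoms n}, monoid.mult = (*), one = 1,
     zero = 0, add = (+)\<rparr>"

definition monomial_ideal :: "nat \<Rightarrow> 'k::field mpoly set \<Rightarrow> bool" where
  "monomial_ideal n I \<longleftrightarrow> (\<exists>M \<subseteq> monoms n. I = genideal (poly_ring n) (mon_poly ` M))"

text \<open>
  Subtraction of exponent functions is pointwise, so
  \<open>v - single i (lookup v i) + single j t\<close> is the monomial \<open>x\<^sub>j\<^sup>t v / x\<^sub>i\<^sup>\<nu>\<close> with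
  \<open>\<nu> = \<nu>\<^sub>i(v)\<close>.
\<close>

definition strong_borel_type :: "nat \<Rightarrow> 'k::field mpoly set \<Rightarrow> bool" where
  "strong_borel_type n I \<longleftrightarrow> monomial_ideal n I \<and>
     (\<forall>v \<in> monoms n. mon_poly v \<in> I \<longrightarrow>
       (\<forall>i j. 1 \<le> j \<and> j < i \<and> i \<le> n \<longrightarrow>
         (\<exists>t \<le> Poly_Mapping.lookup v i.
            mon_poly (v - Poly_Mapping.single i (Poly_Mapping.lookup v i)
                        + Poly_Mapping.single j t) \<in> I)))"

text \<open>The least such ideal with respect to inclusion (the order on sets).\<close>

definition principal_SBT :: "nat \<Rightarrow> monom \<Rightarrow> 'k::field mpoly set" where
  "principal_SBT n u = (LEAST I. strong_borel_type n I \<and> mon_poly u \<in> I)"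

text \<open>
  A graded free module of finite rank, a direct sum of twists \<open>S(-d\<^sub>k)\<close>, is given by the list of
  the degrees \<open>d\<^sub>k\<close> of its basis elements; its elements are the vectors with entries in \<open>S\<close>.
\<close>

definition free_module :: "nat \<Rightarrow> nat list \<Rightarrow> 'k::field mpoly vec set" where
  "free_module n ds =
     {w \<in> carrier_vec (length ds). \<forall>k < length ds. w $ k \<in> carrier (poly_ring n)}"

text \<open>
  The matrix \<open>A\<close> describes a homogeneous \<open>S\<close>-linear map of degree 0 from the graded free
  module with degrees \<open>ds\<close> to the one with degrees \<open>es\<close>: the entry at \<open>(k, l)\<close> is zero or
  homogeneous of degree \<open>ds ! l - es ! k\<close>.
\<close>

definition graded_map ::
  "nat \<Rightarrow> nat list \<Rightarrow> nat list \<Rightarrow> 'k::field mpoly mat \<Rightarrow> bool" where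
  "graded_map n ds es A \<longleftrightarrow> A \<in> carrier_mat (length es) (length ds) \<and>
     (\<forall>k < length es. \<forall>l < length ds. A $$ (k, l) \<in> carrier (poly_ring n) \<and>
        (\<forall>v \<in> Poly_Mapping.keys (A $$ (k, l)). monom_deg v + es ! k = ds ! l))"

text \<open>
  A minimal graded free resolution \<open>\<dots> \<rightarrow> F\<^sub>1 \<rightarrow> F\<^sub>0 \<rightarrow> I \<rightarrow> 0\<close>. The list \<open>d p\<close> holds the degrees
  of the basis of \<open>F\<^sub>p\<close>; \<open>\<phi> (Suc p)\<close> is the differential from \<open>F\<^sub>p\<^sub>+\<^sub>1\<close> to \<open>F\<^sub>p\<close>, and
  \<open>\<phi> 0\<close> is the augmentation from \<open>F\<^sub>0\<close> into \<open>S\<close>, with image \<open>I\<close>. The last condition is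
  minimality: the entries of the differentials lie in the ideal \<open>(x\<^sub>1, \<dots>, x\<^sub>n)\<close>.
\<close>

definition minimal_graded_free_resolution ::
  "nat \<Rightarrow> 'k::field mpoly set \<Rightarrow> (nat \<Rightarrow> nat list) \<Rightarrow> (nat \<Rightarrow> 'k mpoly mat) \<Rightarrow> bool" where
  "minimal_graded_free_resolution n I d \<phi> \<longleftrightarrow>
     graded_map n (d 0) [0] (\<phi> 0) \<and>
     (\<forall>p. graded_map n (d (Suc p)) (d p) (\<phi> (Suc p))) \<and>
     (\<lambda>w. (\<phi> 0 *\<^sub>v w) $ 0) ` free_module n (d 0) = I \<and>
     (\<forall>p. (\<lambda>w. \<phi> (Suc p) *\<^sub>v w) ` free_module n (d (Suc p)) =
            {w \<in> free_module n (d p). \<phi> p *\<^sub>v w = 0\<^sub>v (dim_row (\<phi> p))}) \<and>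
     (\<forall>p. \<forall>k < length (d p). \<forall>l < length (d (Suc p)).
        \<phi> (Suc p) $$ (k, l) \<in> genideal (poly_ring n)
          ((\<lambda>i. mon_poly (Poly_Mapping.single i 1)) ` {1..n}))"

text \<open>
  The graded Betti number \<open>\<beta>\<^sub>i\<^sub>j(I)\<close> is the multiplicity of \<open>S(-j)\<close> in \<open>F\<^sub>i\<close>. Minimal graded free
  resolutions are unique up to isomorphism, so the choice does not matter.
\<close>

definition betti :: "nat \<Rightarrow> 'k::field mpoly set \<Rightarrow> nat \<Rightarrow> nat \<Rightarrow> nat" where
  "betti n I i j =
     count_list ((SOME d. \<exists>\<phi>. minimal_graded_free_resolution n I d \<phi>) i) j"

definition reg :: "nat \<Rightarrow> 'k::field mpoly set \<Rightarrow> int" where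
  "reg n I = Max {int j - int i | i j. betti n I i j \<noteq> 0}"

end

theory Submission
  imports Defs "HOL-Library.Function_Algebras"
begin

text \<open>
  For a set \<open>A\<close> of monomials closed under multiplication, the Koszul homology of the ideal spanned
  by \<open>A\<close> computes the degrees of the minimal generators of its syzygy modules, and it is
  multigraded. If \<open>w / x\<^sub>m \<in> A\<close> for all \<open>w \<in> A\<close> of degree above \<open>e\<close>, where \<open>m\<close> is the largest
  index of a variable of \<open>w\<close>, then in each multidegree the basis vector of the last variable
  contracts the complex above the line \<open>j - p = e\<close>; and \<open>w \<in> A\<close> of degree \<open>e\<close> with
  \<open>w / x\<^sub>m \<notin> A\<close> yields the nontrivial cycle \<open>\<partial> (w / x\<^sub>m \<cdot> e\<^sub>1 \<and> \<dots> \<and> e\<^sub>m)\<close>. So the regularity is the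
  largest degree of such a \<open>w\<close>. The bounds also make every syzygy module finitely generated, so
  that a minimal resolution exists.

  \<open>SBT(u)\<close> is the product of the ideals \<open>(x\<^sub>1\<^sup>a, \<dots>, x\<^sub>k\<^sup>a)\<close> over the factors \<open>x\<^sub>k\<^sup>a\<close> of \<open>u\<close>. A
  monomial in the product of the first \<open>q - 1\<close> of them but not of the first \<open>q\<close>, in the variables
  up to \<open>i\<^sub>q\<close>, has degree at most \<open>\<chi>\<^sub>q\<close> by the pigeonhole principle, and
  \<open>x\<^sub>1\<^sup>s (x\<^sub>1 \<cdots> x\<^sub>k)\<^sup>a\<close> with \<open>s = \<alpha>\<^sub>1 + \<dots> + \<alpha>\<^bsub>q-1\<^esub>\<close>, \<open>k = i\<^sub>q\<close> and \<open>a = \<alpha>\<^sub>q - 1\<close> attains the bound.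
\<close>

section \<open>Koszul complexes\<close>

text \<open>Regularity only asks which Betti numbers are nonzero, so homology enters solely through
  \<open>vanish\<close>, for one homological degree and one total degree at a time.
  \<open>betti\<close> refers to an arbitrarily chosen minimal resolution, and the degrees are
  recovered from Koszul homology for every such resolution. The ideal, the free modules and all
  kernels are families of subsets of one type, so a single complex serves them all, and syzygies are
  reached by dimension shifting at fixed total degree. The division condition comes from stable
  ideals. Suppose that it holds above degree e, and let w in A have degree at least e and last
  variable x_m. For i <= m the product w x_i has degree above e and the same last variable, so w x_i
  / x_m lies in A. The part of degree at least e is therefore stable, and this also keeps the
  boundary of (w / x_m) e_1 ... e_m inside A. The two summands of chi_q are the degree of a product
  of one power from each of the first q - 1 factors and the largest degree of a cofactor in i_q
  variables whose exponents all stay below alpha_q.\<close>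

definition ksign :: "nat \<Rightarrow> nat set \<Rightarrow> 'm::ab_group_add \<Rightarrow> 'm" where
  "ksign i \<tau> x = (if even (card {j\<in>\<tau>. i < j}) then x else - x)"

lemma ksign_0 [simp]: "ksign i \<tau> 0 = 0"
  by (simp add: ksign_def)

lemma ksign_add: "ksign i \<tau> (x + y) = ksign i \<tau> x + ksign i \<tau> y"
  by (simp add: ksign_def)

lemma ksign_sum: "ksign i \<tau> (\<Sum>a\<in>A. f a) = (\<Sum>a\<in>A. ksign i \<tau> (f a))"
  by (simp add: ksign_def sum_negf)

lemma ksign_uminus: "ksign i \<tau> (- x) = - ksign i \<tau> x"
  by (simp add: ksign_def)

lemma ksign_apply: "ksign i \<tau> f k = ksign i \<tau> (f k)"
  by (simp add: ksign_def)

lemma ksign_lookup: "Poly_Mapping.lookup (ksign i \<tau> f) v = ksign i \<tau> (Poly_Mapping.lookup f v)"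
  by (simp add: ksign_def)

lemma ksign_commute: "ksign i \<tau> (ksign j \<sigma> x) = ksign j \<sigma> (ksign i \<tau> x)"
  by (simp add: ksign_def)

lemma ksign_eq_0_iff [simp]: "ksign i \<tau> x = 0 \<longleftrightarrow> x = 0"
  by (simp add: ksign_def)

lemma ksign_insert_greater:
  assumes "finite \<tau>" "j \<notin> \<tau>" "i < j"
  shows "ksign i (insert j \<tau>) x = - ksign i \<tau> x"
proof -
  have "{k \<in> insert j \<tau>. i < k} = insert j {k \<in> \<tau>. i < k}" using assms by auto
  then show ?thesis using assms by (simp add: ksign_def)
qed

lemma ksign_insert_less:
  assumes "j \<le> i"
  shows "ksign i (insert j \<tau>) x = ksign i \<tau> x"
proof -
  have "{k \<in> insert j \<tau>. i < k} = {k \<in> \<tau>. i < k}" using assms by auto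
  then show ?thesis by (simp add: ksign_def)
qed

text \<open>Counting the larger indices gives the last variable the sign +1, so that contracting
  along it later needs no signs.\<close>

lemma ksign_no_greater:
  assumes "\<And>j. j \<in> \<tau> \<Longrightarrow> j \<le> i"
  shows "ksign i \<tau> x = x"
proof -
  have "{k \<in> \<tau>. i < k} = {}" using assms by force
  then show ?thesis unfolding ksign_def by (simp only: card.empty even_zero if_True)
qed

text \<open>The cancellation behind \<open>bd (bd c) = 0\<close>. Antisymmetry is asked for i < j
  only, the case in which the rules for inserting a larger or a smaller index determine both
  signs.\<close>

lemma sum_antisym_eq_0:
  fixes F :: "nat \<Rightarrow> nat \<Rightarrow> 'm::ab_group_add"
  assumes "finite A" and "\<And>i j. i \<in> A \<Longrightarrow> j \<in> A \<Longrightarrow> i < j \<Longrightarrow> F i j = - F j i"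
  shows "(\<Sum>i\<in>A. \<Sum>j\<in>A - {i}. F i j) = 0"
proof -
  let ?L = "SIGMA i:A. {j\<in>A. i < j}" and ?G = "SIGMA i:A. {j\<in>A. j < i}"
  have "(\<Sum>i\<in>A. \<Sum>j\<in>A - {i}. F i j) = (\<Sum>(i, j)\<in>(SIGMA i:A. A - {i}). F i j)"
    using assms(1) by (simp add: sum.Sigma)
  also have "(SIGMA i:A. A - {i}) = ?L \<union> ?G" by auto
  also have "(\<Sum>(i, j)\<in>?L \<union> ?G. F i j) = (\<Sum>(i, j)\<in>?L. F i j) + (\<Sum>(i, j)\<in>?G. F i j)"
    using assms(1) by (intro sum.union_disjoint) auto
  also have "(\<Sum>(i, j)\<in>?L. F i j) = (\<Sum>(i, j)\<in>?G. - F i j)"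
    by (rule sum.reindex_bij_witness[of _ prod.swap prod.swap]) (use assms(2) in auto)
  also have "\<dots> = - (\<Sum>(i, j)\<in>?G. F i j)" by (simp add: sum_negf[symmetric] case_prod_unfold)
  finally show ?thesis by simp
qed

locale koszul =
  fixes n :: nat and X :: "nat \<Rightarrow> 'm::ab_group_add \<Rightarrow> 'm"
  assumes X_add: "X i (a + b) = X i a + X i b"
    and X_commute: "X i (X j a) = X j (X i a)"
begin

lemma X_0 [simp]: "X i 0 = 0"
  using X_add[of i 0 0] by simp

lemma X_uminus: "X i (- a) = - X i a"
  using X_add[of i a "- a"] by (simp add: eq_neg_iff_add_eq_0 add.commute)

lemma X_sum: "X i (\<Sum>a\<in>A. f a) = (\<Sum>a\<in>A. X i (f a))"
  by (induction A rule: infinite_finite_induct) (auto simp: X_add)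

lemma X_ksign: "X i (ksign j \<tau> a) = ksign j \<tau> (X i a)"
  by (simp add: ksign_def X_uminus)

text \<open>The value at \<open>\<tau>\<close> is the coefficient of the wedge product of the e_i
  with i in \<open>\<tau>\<close>. Indices are therefore inserted, where the usual formula on basis
  elements removes them.\<close>

definition bd :: "(nat set \<Rightarrow> 'm) \<Rightarrow> nat set \<Rightarrow> 'm" where
  "bd c \<tau> = (if \<tau> \<subseteq> {1..n} then \<Sum>i\<in>{1..n} - \<tau>. ksign i \<tau> (X i (c (insert i \<tau>))) else 0)"

lemma bd_bd: "bd (bd c) = 0"
proof
  fix \<tau>
  show "bd (bd c) \<tau> = 0 \<tau>"
  proof (cases "\<tau> \<subseteq> {1..n}")
    case True
    then have fin: "finite \<tau>" using finite_subset by blast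
    let ?F = "\<lambda>i j. ksign i \<tau> (ksign j (insert i \<tau>) (X i (X j (c (insert j (insert i \<tau>))))))"
    have "bd (bd c) \<tau> = (\<Sum>i\<in>{1..n} - \<tau>. \<Sum>j\<in>{1..n} - \<tau> - {i}. ?F i j)"
    proof -
      have "bd c (insert i \<tau>) = (\<Sum>j\<in>{1..n} - \<tau> - {i}. ksign j (insert i \<tau>) (X j (c (insert j (insert i \<tau>)))))"
        if "i \<in> {1..n} - \<tau>" for i
      proof -
        have "{1..n} - insert i \<tau> = {1..n} - \<tau> - {i}" by blast
        then show ?thesis using that True by (simp add: bd_def)
      qed
      then show ?thesis using True unfolding bd_def[of "bd c"]
        by (simp add: X_sum ksign_sum X_ksign)
    qed
    also have "\<dots> = 0"
    proof (rule sum_antisym_eq_0)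
      fix i j assume ij: "i \<in> {1..n} - \<tau>" "j \<in> {1..n} - \<tau>" "i < j"
      show "?F i j = - ?F j i"
        using ij fin by (simp add: ksign_insert_greater ksign_insert_less ksign_uminus
            ksign_commute[of i] X_commute[of i] insert_commute)
    qed simp
    finally show ?thesis by simp
  qed (simp add: bd_def)
qed

lemma bd_add: "bd (c + d) = bd c + bd d"
  by (auto simp: bd_def fun_eq_iff X_add ksign_add sum.distrib)

lemma bd_uminus: "bd (- c) = - bd c"
  by (auto simp: bd_def fun_eq_iff X_uminus ksign_uminus sum_negf)

lemma bd_diff: "bd (c - d) = bd c - bd d"
  using bd_add[of c "- d"] bd_uminus[of d] by simp

definition hom_of :: "('m \<Rightarrow> 'm) \<Rightarrow> bool" where
  "hom_of f \<longleftrightarrow> (\<forall>a b. f (a + b) = f a + f b) \<and> (\<forall>i a. f (X i a) = X i (f a))"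

lemma hom_of_0: "hom_of f \<Longrightarrow> f 0 = 0"
  unfolding hom_of_def by (metis add_cancel_left_left)

lemma hom_of_uminus: "hom_of f \<Longrightarrow> f (- a) = - f a"
  using hom_of_0[of f] unfolding hom_of_def by (metis add.right_inverse minus_unique)

lemma hom_of_diff: "hom_of f \<Longrightarrow> f (a - b) = f a - f b"
  using hom_of_uminus[of f b] unfolding hom_of_def by (metis diff_conv_add_uminus)

lemma hom_of_sum: "hom_of f \<Longrightarrow> f (\<Sum>a\<in>A. g a) = (\<Sum>a\<in>A. f (g a))"
  by (induction A rule: infinite_finite_induct) (auto simp: hom_of_0, auto simp: hom_of_def)

lemma bd_hom: "hom_of f \<Longrightarrow> bd (\<lambda>\<tau>. f (c \<tau>)) = (\<lambda>\<tau>. f (bd c \<tau>))"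
proof -
  assume f: "hom_of f"
  have "f (ksign i \<tau> x) = ksign i \<tau> (f x)" for i \<tau> x
    using f by (simp add: ksign_def hom_of_uminus)
  moreover have "f (X i x) = X i (f x)" for i x using f by (simp add: hom_of_def)
  ultimately show ?thesis using f by (auto simp: bd_def fun_eq_iff hom_of_sum hom_of_0)
qed

section \<open>Graded families of subsets and homogeneous chains\<close>

definition graded_sub :: "(int \<Rightarrow> 'm set) \<Rightarrow> bool" where
  "graded_sub M \<longleftrightarrow> (\<forall>a. 0 \<in> M a \<and> (\<forall>x\<in>M a. \<forall>y\<in>M a. x + y \<in> M a) \<and> (\<forall>x\<in>M a. - x \<in> M a) \<and>
     (\<forall>x\<in>M a. \<forall>i\<in>{1..n}. X i x \<in> M (a + 1)))"

lemma graded_subD: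
  assumes "graded_sub M"
  shows "0 \<in> M a" "x \<in> M a \<Longrightarrow> y \<in> M a \<Longrightarrow> x + y \<in> M a" "x \<in> M a \<Longrightarrow> - x \<in> M a"
    "x \<in> M a \<Longrightarrow> i \<in> {1..n} \<Longrightarrow> X i x \<in> M (a + 1)"
  using assms unfolding graded_sub_def by blast+

lemma graded_sub_diff: "graded_sub M \<Longrightarrow> x \<in> M a \<Longrightarrow> y \<in> M a \<Longrightarrow> x - y \<in> M a"
  using graded_subD(2)[of M x a "- y"] graded_subD(3)[of M y a] by simp

lemma graded_sub_sum: "graded_sub M \<Longrightarrow> (\<And>x. x \<in> A \<Longrightarrow> f x \<in> M a) \<Longrightarrow> (\<Sum>x\<in>A. f x) \<in> M a"
  by (induction A rule: infinite_finite_induct) (auto intro: graded_subD)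

lemma graded_sub_ksign: "graded_sub M \<Longrightarrow> x \<in> M a \<Longrightarrow> ksign i \<tau> x \<in> M a"
  by (auto simp: ksign_def graded_subD)

lemma graded_sub_kernel:
  assumes "graded_sub F" "hom_of f"
  shows "graded_sub (\<lambda>a. {w \<in> F a. f w = 0})"
  using graded_subD[OF assms(1)] hom_of_0[OF assms(2)] hom_of_uminus[OF assms(2)] assms(2)
  unfolding graded_sub_def hom_of_def by auto

text \<open>Each e_i has degree 1, so in total degree j the coefficients of a p-chain have degree j
  - p. The value 0 at all other sets makes equality of chains equality of functions.\<close>

definition chain :: "(int \<Rightarrow> 'm set) \<Rightarrow> nat \<Rightarrow> int \<Rightarrow> (nat set \<Rightarrow> 'm) set" where
  "chain M p j = {c. \<forall>\<tau>. if \<tau> \<subseteq> {1..n} \<and> card \<tau> = p then c \<tau> \<in> M (j - int p) else c \<tau> = 0}"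

lemma chainI:
  "(\<And>\<tau>. \<tau> \<subseteq> {1..n} \<Longrightarrow> card \<tau> = p \<Longrightarrow> c \<tau> \<in> M (j - int p)) \<Longrightarrow>
   (\<And>\<tau>. \<not> (\<tau> \<subseteq> {1..n} \<and> card \<tau> = p) \<Longrightarrow> c \<tau> = 0) \<Longrightarrow> c \<in> chain M p j"
  by (auto simp: chain_def)

lemma chainD: "c \<in> chain M p j \<Longrightarrow> \<tau> \<subseteq> {1..n} \<Longrightarrow> card \<tau> = p \<Longrightarrow> c \<tau> \<in> M (j - int p)"
  unfolding chain_def by (drule CollectD, drule spec[of _ \<tau>]) auto

lemma chain_eq_0: "c \<in> chain M p j \<Longrightarrow> \<not> (\<tau> \<subseteq> {1..n} \<and> card \<tau> = p) \<Longrightarrow> c \<tau> = 0"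
  unfolding chain_def by (drule CollectD, drule spec[of _ \<tau>]) auto

lemma chain_diff: "graded_sub M \<Longrightarrow> c \<in> chain M p j \<Longrightarrow> d \<in> chain M p j \<Longrightarrow> c - d \<in> chain M p j"
  by (rule chainI) (simp_all add: chainD chain_eq_0 graded_sub_diff)

lemma bd_chain:
  assumes "graded_sub M" "c \<in> chain M (Suc p) j"
  shows "bd c \<in> chain M p j"
  unfolding chain_def
proof (intro CollectI allI)
  fix \<tau>
  show "if \<tau> \<subseteq> {1..n} \<and> card \<tau> = p then bd c \<tau> \<in> M (j - int p) else bd c \<tau> = 0"
  proof (cases "\<tau> \<subseteq> {1..n}")
    case True
    then have fin: "finite \<tau>" using finite_subset by blast
    have *: "X i (c (insert i \<tau>)) \<in> M (j - int p)" if "i \<in> {1..n} - \<tau>" "card \<tau> = p" for i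
    proof -
      have "c (insert i \<tau>) \<in> M (j - int (Suc p))"
        using assms(2) that True fin unfolding chain_def by (auto dest: spec[of _ "insert i \<tau>"])
      from graded_subD(4)[OF assms(1) this, of i] that(1) show ?thesis by simp
    qed
    have "c (insert i \<tau>) = 0" if "i \<in> {1..n} - \<tau>" "card \<tau> \<noteq> p" for i
      using assms(2) that True fin unfolding chain_def by (auto dest: spec[of _ "insert i \<tau>"])
    then show ?thesis using * assms(1) True
      by (auto simp: bd_def intro!: graded_sub_sum graded_sub_ksign sum.neutral)
  qed (simp add: bd_def)
qed

lemma bd_chain_0: "c \<in> chain M 0 j \<Longrightarrow> bd c = 0"
proof -
  assume c: "c \<in> chain M 0 j"
  have "c (insert i \<tau>) = 0" if "\<tau> \<subseteq> {1..n}" for i \<tau>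
    using c that finite_subset[OF that] unfolding chain_def
    by (auto dest!: spec[of _ "insert i \<tau>"] split: if_splits)
  then show ?thesis by (auto simp: bd_def fun_eq_iff)
qed

lemma chain_image_lift:
  assumes "c \<in> chain (\<lambda>a. f ` F a) p j" "hom_of f"
  obtains g where "g \<in> chain F p j" "c = (\<lambda>\<tau>. f (g \<tau>))"
proof -
  have "\<forall>\<tau>. \<exists>w. (if \<tau> \<subseteq> {1..n} \<and> card \<tau> = p then w \<in> F (j - int p) else w = 0) \<and> f w = c \<tau>"
  proof
    fix \<tau>
    show "\<exists>w. (if \<tau> \<subseteq> {1..n} \<and> card \<tau> = p then w \<in> F (j - int p) else w = 0) \<and> f w = c \<tau>"
    proof (cases "\<tau> \<subseteq> {1..n} \<and> card \<tau> = p")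
      case True
      then have "c \<tau> \<in> f ` F (j - int p)" using assms(1) unfolding chain_def by auto
      then obtain w where "c \<tau> = f w" "w \<in> F (j - int p)" by (rule imageE)
      then show ?thesis using True by auto
    next
      case False
      then have "c \<tau> = 0" using assms(1) unfolding chain_def by auto
      then show ?thesis using False hom_of_0[OF assms(2)] by auto
    qed
  qed
  from choice[OF this] obtain g where
    "\<forall>\<tau>. (if \<tau> \<subseteq> {1..n} \<and> card \<tau> = p then g \<tau> \<in> F (j - int p) else g \<tau> = 0) \<and> f (g \<tau>) = c \<tau>" ..
  then show thesis by (intro that[of g]) (auto simp: chain_def fun_eq_iff)
qed

lemma hom_of_chain: "hom_of f \<Longrightarrow> c \<in> chain F p j \<Longrightarrow> (\<lambda>\<tau>. f (c \<tau>)) \<in> chain (\<lambda>a. f ` F a) p j"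
  using hom_of_0[of f] by (intro chainI) (simp_all add: chainD chain_eq_0)

text \<open>\<open>vanish M p j\<close> says that the degree \<open>j\<close> part of the \<open>p\<close>-th Koszul homology of \<open>M\<close> is zero.\<close>

definition vanish :: "(int \<Rightarrow> 'm set) \<Rightarrow> nat \<Rightarrow> int \<Rightarrow> bool" where
  "vanish M p j \<longleftrightarrow> (\<forall>c\<in>chain M p j. bd c = 0 \<longrightarrow> (\<exists>c'\<in>chain M (Suc p) j. bd c' = c))"

text \<open>Every 0-chain is a cycle, so the zeroth homology is the quotient of M by (x_1, ..., x_n)
  M. This is how vanishing bounds the degrees of generators.\<close>

lemma vanish_0_iff:
  assumes M: "graded_sub M"
  shows "vanish M 0 j \<longleftrightarrow> (\<forall>w\<in>M j. \<exists>g. (\<forall>i\<in>{1..n}. g i \<in> M (j - 1)) \<and> w = (\<Sum>i\<in>{1..n}. X i (g i)))"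
    (is "_ \<longleftrightarrow> ?R")
proof
  assume v: "vanish M 0 j"
  show ?R
  proof
    fix w assume w: "w \<in> M j"
    define c where "c \<tau> = (if \<tau> = {} then w else 0)" for \<tau> :: "nat set"
    have c: "c \<in> chain M 0 j" using w by (auto simp: chain_def c_def dest: finite_subset)
    obtain c' where c': "c' \<in> chain M (Suc 0) j" "bd c' = c"
      using v c bd_chain_0[OF c] unfolding vanish_def by blast
    have "c' {i} \<in> M (j - 1)" if "i \<in> {1..n}" for i
      using c'(1) that unfolding chain_def by (auto dest!: spec[of _ "{i}"])
    moreover have "w = (\<Sum>i\<in>{1..n}. X i (c' {i}))"
      using fun_cong[OF c'(2), of "{}"] by (simp add: bd_def c_def ksign_def)
    ultimately show "\<exists>g. (\<forall>i\<in>{1..n}. g i \<in> M (j - 1)) \<and> w = (\<Sum>i\<in>{1..n}. X i (g i))"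
      by (intro exI[of _ "\<lambda>i. c' {i}"] conjI ballI)
  qed
next
  assume R: ?R
  show "vanish M 0 j" unfolding vanish_def
  proof (intro ballI impI)
    fix c assume c: "c \<in> chain M 0 j"
    then have "c {} \<in> M j" unfolding chain_def by (auto dest!: spec[of _ "{}"])
    with R obtain g where g: "\<forall>i\<in>{1..n}. g i \<in> M (j - 1)" "c {} = (\<Sum>i\<in>{1..n}. X i (g i))" by blast
    define c' where "c' \<tau> = (if \<tau> \<subseteq> {1..n} \<and> card \<tau> = 1 then g (the_elem \<tau>) else 0)" for \<tau>
    have c': "c' \<in> chain M (Suc 0) j"
      using g(1) by (auto simp: chain_def c'_def card_Suc_eq)
    have "bd c' \<tau> = c \<tau>" for \<tau>
    proof (cases "\<tau> = {}")
      case True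
      then show ?thesis using g(2) by (simp add: bd_def c'_def ksign_def)
    next
      case False
      have "c \<tau> = 0" using False c unfolding chain_def
        by (auto dest!: spec[of _ \<tau>] split: if_splits dest: finite_subset)
      moreover have "bd c' \<tau> = 0"
        using bd_chain[OF M c'] False unfolding chain_def
        by (auto dest!: spec[of _ \<tau>] split: if_splits dest: finite_subset)
      ultimately show ?thesis by simp
    qed
    then show "\<exists>c'\<in>chain M (Suc 0) j. bd c' = c" using c' by blast
  qed
qed

text \<open>
  The connecting map of the short exact sequence \<open>0 \<rightarrow> N \<rightarrow> F \<rightarrow> M \<rightarrow> 0\<close> with \<open>N\<close> the kernel of
  \<open>f\<close>. For \<open>p = 0\<close> the hypothesis \<open>lift\<close> says that \<open>N\<close> is contained in the submodule
  \<open>(x\<^sub>1, \<dots>, x\<^sub>n) F\<close>; for \<open>p > 0\<close> it follows from acyclicity of \<open>F\<close>.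
\<close>

lemma vanish_shift:
  fixes F f
  defines "N \<equiv> (\<lambda>a. {w \<in> F a. f w = 0})" and "M \<equiv> (\<lambda>a. f ` F a)"
  assumes F: "graded_sub F" and f: "hom_of f"
    and acyclic: "vanish F (Suc p) j"
    and lift: "\<And>c. c \<in> chain N p j \<Longrightarrow> bd c = 0 \<Longrightarrow> \<exists>g\<in>chain F (Suc p) j. bd g = c"
  shows "vanish M (Suc p) j \<longleftrightarrow> vanish N p j"
proof
  have N: "graded_sub N" unfolding N_def by (rule graded_sub_kernel[OF F f])
  have chainN: "c \<in> chain N q j" if "c \<in> chain F q j" "(\<lambda>\<tau>. f (c \<tau>)) = 0" for c q
    using chainD[OF that(1)] chain_eq_0[OF that(1)] fun_cong[OF that(2)] by (intro chainI) (auto simp: N_def)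
  have chainF: "c \<in> chain F q j" if "c \<in> chain N q j" for c q
    using chainD[OF that] chain_eq_0[OF that] by (intro chainI) (auto simp: N_def)
  have fN: "f (c \<tau>) = 0" if "c \<in> chain N q j" for c q \<tau>
    using chainD[OF that, of \<tau>] chain_eq_0[OF that, of \<tau>] hom_of_0[OF f]
    by (cases "\<tau> \<subseteq> {1..n} \<and> card \<tau> = q") (auto simp: N_def)
  {
    assume v: "vanish M (Suc p) j"
    show "vanish N p j" unfolding vanish_def
    proof (intro ballI impI)
      fix c assume c: "c \<in> chain N p j" "bd c = 0"
      obtain g where g: "g \<in> chain F (Suc p) j" "bd g = c" using lift[OF c] by blast
      have "(\<lambda>\<tau>. f (g \<tau>)) \<in> chain M (Suc p) j" unfolding M_def by (rule hom_of_chain[OF f g(1)])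
      moreover have "bd (\<lambda>\<tau>. f (g \<tau>)) = 0"
        using fN[OF c(1)] by (simp add: bd_hom[OF f] g(2) fun_eq_iff)
      ultimately obtain h where h: "h \<in> chain M (Suc (Suc p)) j" "bd h = (\<lambda>\<tau>. f (g \<tau>))"
        using v unfolding vanish_def by blast
      obtain h' where h': "h' \<in> chain F (Suc (Suc p)) j" "h = (\<lambda>\<tau>. f (h' \<tau>))"
        using chain_image_lift[OF h(1)[unfolded M_def] f] by blast
      \<comment> \<open>The lift g has boundary c but need not lie over N. Subtracting the boundary
        of h' makes its image under f zero and does not change its boundary.\<close>
      have "g - bd h' \<in> chain N (Suc p) j"
      proof (rule chainN)
        show "g - bd h' \<in> chain F (Suc p) j"
          by (rule chain_diff[OF F g(1) bd_chain[OF F h'(1)]])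
        show "(\<lambda>\<tau>. f ((g - bd h') \<tau>)) = 0"
          using h(2) by (simp add: h'(2) bd_hom[OF f] fun_eq_iff hom_of_diff[OF f])
      qed
      moreover have "bd (g - bd h') = c" by (simp add: bd_diff bd_bd g(2))
      ultimately show "\<exists>c'\<in>chain N (Suc p) j. bd c' = c" by blast
    qed
  }
  {
    assume v: "vanish N p j"
    show "vanish M (Suc p) j" unfolding vanish_def
    proof (intro ballI impI)
      fix c assume c: "c \<in> chain M (Suc p) j" "bd c = 0"
      obtain g where g: "g \<in> chain F (Suc p) j" "c = (\<lambda>\<tau>. f (g \<tau>))"
        using chain_image_lift[OF c(1)[unfolded M_def] f] by blast
      have "bd g \<in> chain N p j"
        using chainN[OF bd_chain[OF F g(1)]] c(2) by (simp add: g(2) bd_hom[OF f])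
      then obtain h where h: "h \<in> chain N (Suc p) j" "bd h = bd g"
        using v bd_bd unfolding vanish_def by blast
      have "g - h \<in> chain F (Suc p) j" by (rule chain_diff[OF F g(1) chainF[OF h(1)]])
      moreover have "bd (g - h) = 0" by (simp add: bd_diff h(2))
      ultimately obtain k where k: "k \<in> chain F (Suc (Suc p)) j" "bd k = g - h"
        using acyclic unfolding vanish_def by blast
      have "bd (\<lambda>\<tau>. f (k \<tau>)) = c"
        using fN[OF h(1)] by (simp add: bd_hom[OF f] k(2) g(2) hom_of_diff[OF f] fun_eq_iff)
      then show "\<exists>c'\<in>chain M (Suc (Suc p)) j. bd c' = c"
        using hom_of_chain[OF f k(1)] unfolding M_def by blast
    qed
  }
qed

end

section \<open>Koszul homology of monomial ideals\<close>

abbreviation "lookup \<equiv> Poly_Mapping.lookup"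
abbreviation "keys \<equiv> Poly_Mapping.keys"
abbreviation "single \<equiv> Poly_Mapping.single"

section \<open>Degrees, supports and division of monomials\<close>

lemma monom_deg_eq_sum:
  assumes "finite A" "keys v \<subseteq> A"
  shows "monom_deg v = (\<Sum>i\<in>A. lookup v i)"
  unfolding monom_deg_def using assms by (intro sum.mono_neutral_left) (auto simp: in_keys_iff)

lemma monom_deg_add: "monom_deg (v + w) = monom_deg v + monom_deg w"
  by (simp add: monom_deg_eq_sum[of "keys v \<union> keys w"] keys_add lookup_add sum.distrib)

lemma monom_deg_single [simp]: "monom_deg (single i a) = a"
  by (simp add: monom_deg_def)

lemma monom_deg_0 [simp]: "monom_deg 0 = 0"
  by (simp add: monom_deg_def)

lemma monom_deg_eq_0_iff [simp]: "monom_deg v = 0 \<longleftrightarrow> v = 0"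
proof
  assume "monom_deg v = 0"
  then have "\<And>i. lookup v i = 0" unfolding monom_deg_def by (auto simp: in_keys_iff)
  then show "v = 0" by (simp add: poly_mapping_eqI)
qed simp

lemma keys_add_nat: "keys (v + w :: monom) = keys v \<union> keys w"
  by (auto simp: in_keys_iff lookup_add)

lemma monoms_0 [simp]: "0 \<in> monoms n"
  by (simp add: monoms_def)

lemma monoms_add [simp]: "v + w \<in> monoms n \<longleftrightarrow> v \<in> monoms n \<and> w \<in> monoms n"
  by (simp add: monoms_def keys_add_nat)

lemma monoms_single [simp]: "i \<in> {1..n} \<Longrightarrow> single i a \<in> monoms n"
  by (simp add: monoms_def)

lemma monoms_diff: "v \<in> monoms n \<Longrightarrow> v - w \<in> monoms n"
  by (auto simp: monoms_def in_keys_iff lookup_minus)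

lemma diff_single_add: "i \<in> keys v \<Longrightarrow> v - single i (Suc 0) + single i (Suc 0) = (v :: monom)"
  by (intro poly_mapping_eqI) (auto simp: lookup_add lookup_minus lookup_single when_def in_keys_iff)

lemma keys_diff_single: "keys (v - single i (Suc 0) :: monom) \<subseteq> keys v"
  by (auto simp: in_keys_iff lookup_minus)

lemma insert_keys_diff_single: "i \<in> keys v \<Longrightarrow> insert i (keys (v - single i (Suc 0))) = keys (v :: monom)"
  using keys_add_nat[of "v - single i (Suc 0)" "single i (Suc 0)"] by (simp add: diff_single_add)

lemma monom_deg_diff_single: "i \<in> keys v \<Longrightarrow> Suc (monom_deg (v - single i (Suc 0))) = monom_deg v"
  using monom_deg_add[of "v - single i (Suc 0)" "single i (Suc 0)"] by (simp add: diff_single_add)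

lemma lookup_mon_poly_times:
  fixes u :: monom
  shows "lookup (single u c * f) v = (if \<exists>w. v = u + w then c * lookup f (v - u) else (0::'k::field))"
proof -
  have "lookup (single u c * f) v = (\<Sum>l. (c when u = l) * (\<Sum>q. lookup f q when v = l + q))"
    by (simp add: lookup_mult lookup_single)
  also have "\<dots> = (\<Sum>l. (c * (\<Sum>q. lookup f q when v = l + q)) when l = u)"
    by (intro Sum_any.cong) (auto simp: when_def)
  also have "\<dots> = c * (\<Sum>q. lookup f q when v = u + q)" by simp
  also have "(\<Sum>q. lookup f q when v = u + q) = (if \<exists>w. v = u + w then lookup f (v - u) else 0)"
  proof (cases "\<exists>w. v = u + w")
    case True
    then obtain w where w: "v = u + w" by blast
    have "(\<Sum>q. lookup f q when v = u + q) = (\<Sum>q. lookup f q when q = w)"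
      unfolding w by (intro Sum_any.cong) (auto simp: when_def)
    then show ?thesis using w by auto
  qed (simp add: when_def)
  finally show ?thesis by simp
qed

text \<open>Vectors are functions on all indices, so free modules of every rank share one type; an
  ideal occupies the entry at index 0.\<close>

definition var_mult :: "nat \<Rightarrow> (nat \<Rightarrow> 'k::field mpoly) \<Rightarrow> nat \<Rightarrow> 'k mpoly" where
  "var_mult i w = (\<lambda>k. mon_poly (single i 1) * w k)"

lemma lookup_var_mult:
  "lookup (var_mult i w k) v = (if i \<in> keys v then lookup (w k) (v - single i 1) else 0)"
proof -
  have "(\<exists>w. v = single i 1 + w) \<longleftrightarrow> i \<in> keys v"
    using diff_single_add[of i v] by (auto simp: in_keys_iff lookup_add add.commute) (metis add.commute)
  then show ?thesis by (simp add: var_mult_def mon_poly_def lookup_mon_poly_times)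
qed

interpretation koszul n "var_mult :: nat \<Rightarrow> (nat \<Rightarrow> 'k::field mpoly) \<Rightarrow> _" for n
  by unfold_locales (simp_all add: var_mult_def fun_eq_iff algebra_simps)

lemma sum_fun_apply: "(\<Sum>a\<in>A. f a) x = (\<Sum>a\<in>A. f a x)"
  by (induction A rule: infinite_finite_induct) auto

lemma lookup_bd:
  "lookup (bd n c \<tau> k) v = (if \<tau> \<subseteq> {1..n} then \<Sum>i\<in>{1..n} - \<tau>. ksign i \<tau>
     (if i \<in> keys v then lookup (c (insert i \<tau>) k) (v - single i 1) else 0) else 0)"
  unfolding bd_def by (simp add: sum_fun_apply lookup_sum ksign_apply ksign_lookup lookup_var_mult)

text \<open>
  In multidegree \<open>b\<close>, multiplication by the basis vector of the largest variable occurring in \<open>b\<close>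
  is a contracting homotopy of the Koszul complex of a monomial ideal, as long as it does not leave
  the ideal.
\<close>

definition cone :: "(nat set \<Rightarrow> nat \<Rightarrow> 'k::field mpoly) \<Rightarrow> nat set \<Rightarrow> nat \<Rightarrow> 'k mpoly" where
  "cone c \<sigma> k = Abs_poly_mapping (\<lambda>v. let m = Max (keys v \<union> \<sigma>) in
     if finite \<sigma> \<and> m \<in> \<sigma> then lookup (c (\<sigma> - {m}) k) (v + single m 1) else 0)"

lemma lookup_cone:
  "lookup (cone c \<sigma> k) v = (let m = Max (keys v \<union> \<sigma>) in
     if finite \<sigma> \<and> m \<in> \<sigma> then lookup (c (\<sigma> - {m}) k) (v + single m 1) else 0)"
proof -
  let ?g = "\<lambda>v. let m = Max (keys v \<union> \<sigma>) in
     if finite \<sigma> \<and> m \<in> \<sigma> then lookup (c (\<sigma> - {m}) k) (v + single m 1) else 0"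
  have "finite {v. ?g v \<noteq> 0}"
  proof (cases "finite \<sigma>")
    case True
    have "{v. ?g v \<noteq> 0} \<subseteq> (\<Union>m\<in>\<sigma>. (\<lambda>u. u - single m 1) ` keys (c (\<sigma> - {m}) k))"
    proof
      fix v assume "v \<in> {v. ?g v \<noteq> 0}"
      then obtain m where m: "m \<in> \<sigma>" "v + single m 1 \<in> keys (c (\<sigma> - {m}) k)"
        by (auto simp: Let_def in_keys_iff split: if_splits)
      then show "v \<in> (\<Union>m\<in>\<sigma>. (\<lambda>u. u - single m 1) ` keys (c (\<sigma> - {m}) k))"
        by (intro UN_I[OF m(1)] image_eqI[of _ _ "v + single m 1"]) simp_all
    qed
    then show ?thesis by (rule finite_subset) (use True in simp)
  qed simp
  then show ?thesis unfolding cone_def by simp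
qed

text \<open>Coefficients are compared multidegree by multidegree. If the last index m of the
  multidegree is not in \<open>\<tau>\<close>, only the insertion of m contributes; if it is, the
  cycle condition gives the coefficient. \<open>nz\<close> excludes multidegree 0, where there is no
  variable to contract along.\<close>

lemma bd_cone:
  assumes supp: "\<And>\<tau>. \<not> \<tau> \<subseteq> {1..n} \<Longrightarrow> c \<tau> = 0" and mon: "\<And>\<tau> k. keys (c \<tau> k) \<subseteq> monoms n"
    and nz: "\<And>k. 0 \<notin> keys (c {} k)" and cycle: "bd n c = 0"
  shows "bd n (cone c) = c"
proof (intro ext poly_mapping_eqI)
  fix \<tau> :: "nat set" and k :: nat and v :: monom
  let ?m = "Max (keys v \<union> \<tau>)"
  show "lookup (bd n (cone c) \<tau> k) v = lookup (c \<tau> k) v"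
  proof (cases "\<tau> \<subseteq> {1..n}")
    case False
    then show ?thesis by (simp add: lookup_bd supp)
  next
    case True
    then have fin: "finite \<tau>" using finite_subset by blast
    have Max: "Max (keys (v - single i 1) \<union> insert i \<tau>) = ?m" if "i \<in> keys v" for i
      using insert_keys_diff_single[OF that] by (metis One_nat_def Un_insert_left Un_insert_right)
    have bd: "lookup (bd n (cone c) \<tau> k) v = (\<Sum>i\<in>{1..n} - \<tau>. ksign i \<tau>
      (if i \<in> keys v \<and> ?m \<in> insert i \<tau> then
         lookup (c (insert i \<tau> - {?m}) k) (v - single i 1 + single ?m 1) else 0))"
      using True fin by (auto simp: lookup_bd lookup_cone Let_def Max[simplified] intro!: sum.cong)
    consider "keys v \<union> \<tau> = {}" | "keys v \<union> \<tau> \<noteq> {}" "?m \<notin> \<tau>" | "?m \<in> \<tau>" by blast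
    then show ?thesis
    proof cases
      case 1
      then have "v = 0" "\<tau> = {}" by (auto intro: poly_mapping_eqI simp: in_keys_iff)
      then show ?thesis using nz by (simp add: lookup_bd in_keys_iff)
    next
      case 2
      then have m: "?m \<in> keys v" using Max_in[of "keys v \<union> \<tau>"] fin by auto
      have "lookup (bd n (cone c) \<tau> k) v =
        (\<Sum>i\<in>{1..n} - \<tau>. if i = ?m then lookup (c \<tau> k) v else 0)"
        unfolding bd
      proof (intro sum.cong refl)
        fix i assume i: "i \<in> {1..n} - \<tau>"
        have "ksign ?m \<tau> x = x" for x :: 'a
          using fin by (intro ksign_no_greater) simp
        then show "ksign i \<tau> (if i \<in> keys v \<and> ?m \<in> insert i \<tau> then
           lookup (c (insert i \<tau> - {?m}) k) (v - single i 1 + single ?m 1) else 0) =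
          (if i = ?m then lookup (c \<tau> k) v else 0)"
          using 2 m diff_single_add[OF m] by auto
      qed
      also have "\<dots> = (if ?m \<in> {1..n} then lookup (c \<tau> k) v else 0)" using 2 by simp
      also have "\<dots> = lookup (c \<tau> k) v"
      proof -
        have "v \<in> monoms n \<Longrightarrow> ?m \<in> {1..n}" using m unfolding monoms_def by blast
        then have "?m \<notin> {1..n} \<Longrightarrow> v \<notin> keys (c \<tau> k)" using mon[of \<tau> k] by blast
        then show ?thesis by (auto simp: in_keys_iff)
      qed
      finally show ?thesis .
    next
      case 3
      \<comment> \<open>The cycle condition is read at the coefficient of x_m times the monomial v,
        on \<open>\<tau>\<close> without m. The summand for m is the wanted coefficient. The others
        are the terms of \<open>bd n (cone c)\<close> with the opposite sign, since m exceeds i and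
        belongs to \<open>\<tau>\<close> but not to \<open>?t\<close>.\<close>
      let ?t = "\<tau> - {?m}" and ?v = "v + single ?m 1"
      have "0 = lookup (bd n c ?t k) ?v" by (simp add: cycle)
      also have "\<dots> = (\<Sum>i\<in>{1..n} - ?t. ksign i ?t
        (if i \<in> keys ?v then lookup (c (insert i ?t) k) (?v - single i 1) else 0))"
      proof -
        have "?t \<subseteq> {1..n}" using True by blast
        then show ?thesis unfolding lookup_bd by (rule if_P)
      qed
      also have "{1..n} - ?t = insert ?m ({1..n} - \<tau>)" using 3 True by auto
      also have "(\<Sum>i\<in>insert ?m ({1..n} - \<tau>). ksign i ?t
        (if i \<in> keys ?v then lookup (c (insert i ?t) k) (?v - single i 1) else 0)) =
        ksign ?m ?t (lookup (c \<tau> k) v) + (\<Sum>i\<in>{1..n} - \<tau>. ksign i ?t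
        (if i \<in> keys ?v then lookup (c (insert i ?t) k) (?v - single i 1) else 0))"
        using 3 by (simp add: insert_absorb keys_add_nat)
      also have "ksign ?m ?t (lookup (c \<tau> k) v) = lookup (c \<tau> k) v"
        using fin by (intro ksign_no_greater) simp
      also have "(\<Sum>i\<in>{1..n} - \<tau>. ksign i ?t
        (if i \<in> keys ?v then lookup (c (insert i ?t) k) (?v - single i 1) else 0)) =
        (\<Sum>i\<in>{1..n} - \<tau>. - ksign i \<tau>
      (if i \<in> keys v \<and> ?m \<in> insert i \<tau> then
         lookup (c (insert i \<tau> - {?m}) k) (v - single i 1 + single ?m 1) else 0))"
      proof (intro sum.cong refl)
        fix i assume i: "i \<in> {1..n} - \<tau>"
        then have im: "i \<noteq> ?m" using 3 by auto
        show "ksign i ?t (if i \<in> keys ?v then lookup (c (insert i ?t) k) (?v - single i 1) else 0) =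
          - ksign i \<tau> (if i \<in> keys v \<and> ?m \<in> insert i \<tau> then
            lookup (c (insert i \<tau> - {?m}) k) (v - single i 1 + single ?m 1) else 0)"
        proof (cases "i \<in> keys v")
          case True
          then have "i < ?m" using im fin by (simp add: order.strict_iff_order)
          then have "ksign i \<tau> x = - ksign i ?t x" for x :: 'a
            using ksign_insert_greater[of ?t ?m i x] fin 3 by (simp add: insert_absorb)
          moreover have "?v - single i 1 = v - single i 1 + single ?m 1"
            using True im by (intro poly_mapping_eqI)
              (auto simp: lookup_add lookup_minus lookup_single when_def in_keys_iff)
          moreover have "insert i ?t = insert i \<tau> - {?m}" using im by auto
          ultimately show ?thesis using True 3 by (simp add: keys_add_nat)
        next
          case False
          then show ?thesis using im by (simp add: keys_add_nat)
        qed
      qed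
      finally show ?thesis unfolding bd by (simp add: sum_negf)
    qed
  qed
qed

text \<open>Submodules spanned by monomial multiples of the unit vectors. Prescribing the supports
  entry by entry covers free modules, monomial ideals and families with single monomials left
  out.\<close>

definition mono_fam :: "(nat \<Rightarrow> int \<Rightarrow> monom set) \<Rightarrow> int \<Rightarrow> (nat \<Rightarrow> 'k::field mpoly) set" where
  "mono_fam B a = {w. \<forall>k. keys (w k) \<subseteq> B k a}"

lemma keys_uminus_mpoly: "keys (- f :: 'k::field mpoly) = keys f"
  by (auto simp: in_keys_iff)

lemma keys_var_mult: "keys (var_mult i w k) \<subseteq> (\<lambda>u. u + single i 1) ` keys (w k)"
proof
  fix v assume "v \<in> keys (var_mult i w k)"
  then have "i \<in> keys v" "v - single i 1 \<in> keys (w k)"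
    by (auto simp: in_keys_iff lookup_var_mult split: if_splits)
  then show "v \<in> (\<lambda>u. u + single i 1) ` keys (w k)"
    using diff_single_add[of i v] by (intro image_eqI[of _ _ "v - single i 1"]) simp_all
qed

lemma graded_sub_mono_fam:
  assumes "\<And>k a i u. u \<in> B k a \<Longrightarrow> i \<in> {1..n} \<Longrightarrow> u + single i 1 \<in> B k (a + 1)"
  shows "graded_sub n (mono_fam B :: _ \<Rightarrow> (nat \<Rightarrow> 'k::field mpoly) set)"
  unfolding graded_sub_def
proof (intro allI conjI ballI)
  fix a and x :: "nat \<Rightarrow> 'k mpoly" and i
  assume x: "x \<in> mono_fam B a" and i: "i \<in> {1..n}"
  have "u + single i 1 \<in> B k (a + 1)" if "u \<in> keys (x k)" for u k
    using assms[of u k a i] x i that by (auto simp: mono_fam_def)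
  then show "var_mult i x \<in> mono_fam B (a + 1)"
    using keys_var_mult[of i x] by (fastforce simp: mono_fam_def)
next
  fix a and x y :: "nat \<Rightarrow> 'k mpoly"
  assume "x \<in> mono_fam B a" "y \<in> mono_fam B a"
  then show "x + y \<in> mono_fam B a"
    unfolding mono_fam_def plus_fun_apply using keys_add[of "x _" "y _"] by blast
qed (auto simp: mono_fam_def keys_uminus_mpoly)

text \<open>The contraction divides each coefficient by its last variable, and \<open>desc\<close>
  says that the result stays in the family. Only this division matters, so B may be tailored to a
  single degree.\<close>

lemma vanish_mono_fam:
  assumes mon: "\<And>k a. B k a \<subseteq> monoms n"
    and desc: "\<And>k u. u \<in> B k (j - int p) \<Longrightarrow> u \<noteq> 0 \<Longrightarrow>
      u - single (Max (keys u)) 1 \<in> B k (j - int p - 1)"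
    and nz: "\<And>k. p = 0 \<Longrightarrow> 0 \<notin> B k j"
  shows "vanish n (mono_fam B :: _ \<Rightarrow> (nat \<Rightarrow> 'k::field mpoly) set) p j"
  unfolding vanish_def
proof (intro ballI impI)
  fix c :: "nat set \<Rightarrow> nat \<Rightarrow> 'k mpoly"
  assume c: "c \<in> chain n (mono_fam B) p j" "bd n c = 0"
  have cB: "\<tau> \<subseteq> {1..n} \<and> card \<tau> = p \<and> u \<in> B k (j - int p)" if "u \<in> keys (c \<tau> k)" for u \<tau> k
    using chainD[OF c(1), of \<tau>] chain_eq_0[OF c(1), of \<tau>] that unfolding mono_fam_def
    by (cases "\<tau> \<subseteq> {1..n} \<and> card \<tau> = p") auto
  have "bd n (cone c) = c"
  proof (rule bd_cone[OF _ _ _ c(2)])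
    show "c \<tau> = 0" if "\<not> \<tau> \<subseteq> {1..n}" for \<tau> using chain_eq_0[OF c(1)] that by blast
    show "keys (c \<tau> k) \<subseteq> monoms n" for \<tau> k using cB mon by blast
    show "0 \<notin> keys (c {} k)" for k using cB[of 0 "{}" k] nz[of k] by auto
  qed
  moreover have "cone c \<in> chain n (mono_fam B) (Suc p) j"
  proof -
    have *: "\<sigma> \<subseteq> {1..n} \<and> card \<sigma> = Suc p \<and> v \<in> B k (j - int (Suc p))" if "v \<in> keys (cone c \<sigma> k)" for v \<sigma> k
    proof -
      define m where "m = Max (keys v \<union> \<sigma>)"
      from that have fin: "finite \<sigma>" and m: "m \<in> \<sigma>" and u: "v + single m 1 \<in> keys (c (\<sigma> - {m}) k)"
        by (auto simp: in_keys_iff lookup_cone Let_def m_def split: if_splits)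
      \<comment> \<open>The index m is the largest of the whole multidegree and its variable divides
        the coefficient. Hence it is also the last variable of the coefficient itself, the one in
        \<open>desc\<close>.\<close>
      have "m = Max (keys (v + single m 1))"
        using fin m_def by (intro Max_eqI[symmetric]) (auto simp: keys_add_nat)
      moreover have "v + single m 1 \<noteq> 0" by (metis monom_deg_add monom_deg_eq_0_iff monom_deg_single add_is_0 one_neq_zero)
      ultimately have "v \<in> B k (j - int p - 1)"
        using desc[of "v + single m 1" k] cB[OF u] by simp
      moreover have "m \<in> {1..n}"
        using cB[OF u] mon[of k "j - int p"] unfolding monoms_def by (auto simp: keys_add_nat)
      then have "\<sigma> \<subseteq> {1..n}" using cB[OF u] by auto
      moreover have "card \<sigma> = Suc p"
        using cB[OF u] fin m by (metis card_Suc_Diff1)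
      ultimately show ?thesis by (simp add: algebra_simps)
    qed
    show ?thesis
    proof (rule chainI)
      show "cone c \<sigma> \<in> mono_fam B (j - int (Suc p))" for \<sigma>
        using * unfolding mono_fam_def by blast
      show "cone c \<sigma> = 0" if "\<not> (\<sigma> \<subseteq> {1..n} \<and> card \<sigma> = Suc p)" for \<sigma>
        using * that by (intro ext poly_mapping_eqI) (metis in_keys_iff lookup_zero zero_fun_apply)
    qed
  qed
  ultimately show "\<exists>c'\<in>chain n (mono_fam B) (Suc p) j. bd n c' = c" by blast
qed

section \<open>Acyclic free modules and homology classes of monomial ideals\<close>

definition free_pieces :: "nat \<Rightarrow> nat list \<Rightarrow> nat \<Rightarrow> int \<Rightarrow> monom set" where
  "free_pieces n ds k a = {v \<in> monoms n. k < length ds \<and> int (monom_deg v) + int (ds ! k) = a}"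

definition ideal_pieces :: "monom set \<Rightarrow> nat \<Rightarrow> int \<Rightarrow> monom set" where
  "ideal_pieces A k a = {v \<in> A. k = 0 \<and> int (monom_deg v) = a}"

abbreviation "free_fam n ds \<equiv> mono_fam (free_pieces n ds)"
abbreviation "ideal_fam A \<equiv> mono_fam (ideal_pieces A)"

lemma graded_sub_free: "graded_sub n (free_fam n ds)"
  by (rule graded_sub_mono_fam) (auto simp: free_pieces_def monom_deg_add)

lemma Max_keys_in: "u \<noteq> 0 \<Longrightarrow> Max (keys (u::monom)) \<in> keys u"
  using Max_in[of "keys u"] by (metis finite_keys keys_eq_empty)

text \<open>Division by a variable never leaves the full set of monomials. The index
  \<open>Suc p\<close> avoids homological degree 0, where the constants survive.\<close>

lemma vanish_free: "vanish n (free_fam n ds) (Suc p) j"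
proof (rule vanish_mono_fam)
  fix k u assume u: "u \<in> free_pieces n ds k (j - int (Suc p))" "u \<noteq> 0"
  then show "u - single (Max (keys u)) 1 \<in> free_pieces n ds k (j - int (Suc p) - 1)"
    using monom_deg_diff_single[OF Max_keys_in[OF u(2)]] monoms_diff[of u n]
    by (auto simp: free_pieces_def)
qed (auto simp: free_pieces_def)

lemma vanish_ideal_above:
  assumes "A \<subseteq> monoms n"
    and "\<And>u. u \<in> A \<Longrightarrow> monom_deg u > e \<Longrightarrow> u - single (Max (keys u)) 1 \<in> A"
    and "j > int p + int e"
  shows "vanish n (ideal_fam A) p j"
proof (rule vanish_mono_fam)
  fix k u assume u: "u \<in> ideal_pieces A k (j - int p)" "u \<noteq> 0"
  then show "u - single (Max (keys u)) 1 \<in> ideal_pieces A k (j - int p - 1)"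
    using monom_deg_diff_single[OF Max_keys_in[OF u(2)]] assms(2)[of u] assms(3)
    by (auto simp: ideal_pieces_def)
qed (use assms in \<open>auto simp: ideal_pieces_def\<close>)

text \<open>Coefficients would have negative degree, so every chain is zero. This bounds the
  differences j - p from below in the regularity.\<close>

lemma vanish_ideal_below:
  assumes "j < int p"
  shows "vanish n (ideal_fam A :: _ \<Rightarrow> (nat \<Rightarrow> 'a::field mpoly) set) p j"
  unfolding vanish_def
proof (intro ballI impI)
  fix c :: "nat set \<Rightarrow> nat \<Rightarrow> 'a mpoly" assume c: "c \<in> chain n (ideal_fam A) p j"
  have "c \<tau> = 0" for \<tau>
  proof (cases "\<tau> \<subseteq> {1..n} \<and> card \<tau> = p")
    case True
    then have "\<forall>k. keys (c \<tau> k) \<subseteq> ideal_pieces A k (j - int p)"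
      using chainD[OF c, of \<tau>] by (simp add: mono_fam_def)
    moreover have "ideal_pieces A k (j - int p) = {}" for k
      using assms by (auto simp: ideal_pieces_def)
    ultimately show ?thesis by (simp add: fun_eq_iff)
  next
    case False
    then show ?thesis by (rule chain_eq_0[OF c])
  qed
  then have "c = 0" by (simp add: fun_eq_iff)
  moreover have "0 \<in> chain n (ideal_fam A) (Suc p) j"
    by (rule chainI) (auto simp: mono_fam_def)
  moreover have "bd n 0 = (0 :: nat set \<Rightarrow> nat \<Rightarrow> 'a mpoly)" by (simp add: bd_def fun_eq_iff)
  ultimately show "\<exists>c'\<in>chain n (ideal_fam A) (Suc p) j. bd n c' = c" by blast
qed

text \<open>The cycle bounds (w / x_m) e_1 ... e_m over the whole ring, but w / x_m is outside A.
  Any other chain with that boundary has the same coefficient of w / x_m at e_1 ... e_m, so none has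
  all its coefficients in A.\<close>

lemma not_vanish_ideal:
  assumes A: "A \<subseteq> monoms n" and w: "w \<in> A" "w \<noteq> 0"
  defines "m \<equiv> Max (keys w)"
  assumes nin: "w - single m 1 \<notin> A"
    and inA: "\<And>i. i \<in> {1..m} \<Longrightarrow> w - single m 1 + single i 1 \<in> A"
  shows "\<not> vanish n (ideal_fam A :: _ \<Rightarrow> (nat \<Rightarrow> 'k::field mpoly) set) (m - 1) (int (monom_deg w) + int (m - 1))"
    (is "\<not> vanish n ?I _ ?j")
proof
  assume v: "vanish n ?I (m - 1) ?j"
  have mw: "m \<in> keys w" unfolding m_def by (rule Max_keys_in[OF w(2)])
  have "keys w \<subseteq> {1..n}" using w(1) A by (auto simp: monoms_def)
  then have m: "m \<in> {1..n}" using mw by blast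
  have wmax: "i \<le> m" if "i \<in> keys w" for i using that by (simp add: m_def)
  define c :: "nat set \<Rightarrow> nat \<Rightarrow> 'k mpoly" where
    "c \<tau> k = (if \<tau> = {1..m} \<and> k = 0 then single (w - single m 1) 1 else 0)" for \<tau> k
  have keysbd: "\<exists>i\<in>{1..m}. \<tau> = {1..m} - {i} \<and> k = 0 \<and> v = w - single m 1 + single i 1"
    if "v \<in> keys (bd n c \<tau> k)" for \<tau> k v
  proof -
    from that have "(\<Sum>i\<in>{1..n} - \<tau>. ksign i \<tau>
        (if i \<in> keys v then lookup (c (insert i \<tau>) k) (v - single i 1) else 0)) \<noteq> 0"
      by (auto simp: in_keys_iff lookup_bd split: if_splits)
    then obtain i where i: "i \<in> {1..n} - \<tau>"
      "ksign i \<tau> (if i \<in> keys v then lookup (c (insert i \<tau>) k) (v - single i 1) else 0) \<noteq> 0"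
      by (rule sum.not_neutral_contains_not_neutral)
    then have "i \<notin> \<tau>" "i \<in> keys v" "v - single i 1 \<in> keys (c (insert i \<tau>) k)"
      by (auto simp: in_keys_iff split: if_splits)
    moreover from this(3) have "insert i \<tau> = {1..m}" "k = 0" "v - single i 1 = w - single m 1"
      by (auto simp: c_def split: if_splits)
    ultimately show ?thesis
      using diff_single_add[of i v] by (intro bexI[of _ i]) auto
  qed
  have degw: "monom_deg (w - single m 1 + single i 1) = monom_deg w" for i
    using monom_deg_diff_single[OF mw] by (simp add: monom_deg_add)
  have "bd n c \<in> chain n ?I (m - 1) ?j"
  proof (rule chainI)
    show "bd n c \<tau> \<in> ?I (?j - int (m - 1))" for \<tau>
    proof -
      have "v \<in> ideal_pieces A k (?j - int (m - 1))" if "v \<in> keys (bd n c \<tau> k)" for k v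
        using keysbd[OF that] inA degw by (auto simp: ideal_pieces_def)
      then show ?thesis by (auto simp: mono_fam_def)
    qed
    show "bd n c \<tau> = 0" if "\<not> (\<tau> \<subseteq> {1..n} \<and> card \<tau> = m - 1)" for \<tau>
    proof (intro ext poly_mapping_eqI, rule ccontr)
      fix k v assume "lookup (bd n c \<tau> k) v \<noteq> lookup (0 k) v"
      then have "v \<in> keys (bd n c \<tau> k)" by (simp add: in_keys_iff)
      from keysbd[OF this] that m show False by auto
    qed
  qed
  then obtain c' where c': "c' \<in> chain n ?I (Suc (m - 1)) ?j" "bd n c' = bd n c"
    using v bd_bd unfolding vanish_def by blast
  \<comment> \<open>An index that can be inserted into {1..m - 1} is at least m, and no variable
    beyond x_m divides w. The coefficient of w therefore comes from e_1 ... e_m alone.\<close>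
  have bdw: "lookup (bd n g {1..m - 1} 0) w = lookup (g {1..m} 0) (w - single m 1)"
    for g :: "nat set \<Rightarrow> nat \<Rightarrow> 'k mpoly"
  proof -
    have "lookup (bd n g {1..m - 1} 0) w = (\<Sum>i\<in>{1..n} - {1..m - 1}.
      if i = m then lookup (g {1..m} 0) (w - single m 1) else 0)"
    proof -
      have "ksign i {1..m - 1} (if i \<in> keys w then lookup (g (insert i {1..m - 1}) 0) (w - single i 1) else 0)
        = (if i = m then lookup (g {1..m} 0) (w - single m 1) else 0)" if "i \<in> {1..n} - {1..m - 1}" for i
      proof (cases "i = m")
        case True
        have "insert m {1..m - 1} = {1..m}" using m by auto
        moreover have "ksign m {1..m - 1} x = x" for x :: 'k by (rule ksign_no_greater) auto
        ultimately show ?thesis using True mw by simp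
      next
        case False
        then show ?thesis using that wmax[of i] by auto
      qed
      moreover have "{1..m - 1} \<subseteq> {1..n}" using m by auto
      ultimately show ?thesis unfolding lookup_bd by (simp only: if_True cong: sum.cong)
    qed
    also have "\<dots> = lookup (g {1..m} 0) (w - single m 1)"
      using m by auto
    finally show ?thesis .
  qed
  have "lookup (c' {1..m} 0) (w - single m 1) = 1"
    using bdw[of c'] bdw[of c] c'(2) by (simp add: c_def)
  then have "w - single m 1 \<in> keys (c' {1..m} 0)" by (simp add: in_keys_iff)
  moreover have "c' {1..m} \<in> ?I (?j - int (Suc (m - 1)))"
    using m by (intro chainD[OF c'(1)]) auto
  ultimately show False using nin by (auto simp: mono_fam_def ideal_pieces_def)
qed

section \<open>Minimal graded covers\<close>

text \<open>Multiplication by one term. For v = 0 it is scalar multiplication, which makes the span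
  and independence of K-vector spaces available.\<close>

definition tmul :: "monom \<Rightarrow> 'k \<Rightarrow> (nat \<Rightarrow> 'k::field mpoly) \<Rightarrow> nat \<Rightarrow> 'k mpoly" where
  "tmul v c w = (\<lambda>k. single v c * w k)"

lemma tmul_tmul: "tmul v c (tmul u d w) = tmul (v + u) (c * d) w"
  by (simp add: tmul_def fun_eq_iff mult_single mult.assoc[symmetric])

lemma tmul_add: "tmul v c (w + w') = tmul v c w + tmul v c w'"
  by (simp add: tmul_def fun_eq_iff algebra_simps)

lemma tmul_0 [simp]: "tmul v c 0 = 0"
  by (simp add: tmul_def fun_eq_iff)

lemma tmul_0_1 [simp]: "tmul 0 1 w = w"
  by (simp add: tmul_def)

lemma tmul_uminus: "tmul 0 (- 1) w = - w"
  by (simp add: tmul_def fun_eq_iff single_uminus)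

lemma var_mult_eq_tmul: "var_mult i w = tmul (single i 1) 1 w"
  by (simp add: var_mult_def tmul_def mon_poly_def)

interpretation vs: Vector_Spaces.vector_space "tmul 0 :: 'k::field \<Rightarrow> (nat \<Rightarrow> 'k mpoly) \<Rightarrow> _"
  by unfold_locales (simp_all add: tmul_add tmul_tmul, simp_all add: tmul_def fun_eq_iff single_add algebra_simps)

lemma mpoly_eq_sum: "f = (\<Sum>v\<in>keys f. single v (lookup f v))"
proof (rule poly_mapping_eqI)
  fix u
  have "(\<Sum>v\<in>keys f. lookup f v when v = u) = (\<Sum>v\<in>keys f. if v = u then lookup f v else 0)"
    by (simp add: when_def)
  also have "\<dots> = lookup f u" by (simp add: in_keys_iff)
  finally show "lookup f u = lookup (\<Sum>v\<in>keys f. single v (lookup f v)) u"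
    by (simp add: lookup_sum lookup_single)
qed

lemma mult_eq_sum_tmul: "(\<lambda>k. f * g k) = (\<Sum>v\<in>keys f. tmul v (lookup f v) g)"
  by (subst mpoly_eq_sum) (simp add: fun_eq_iff sum_fun_apply tmul_def sum_distrib_right)

definition graded_module :: "nat \<Rightarrow> (int \<Rightarrow> (nat \<Rightarrow> 'k::field mpoly) set) \<Rightarrow> bool" where
  "graded_module n N \<longleftrightarrow> (\<forall>a. 0 \<in> N a \<and> (\<forall>x\<in>N a. \<forall>y\<in>N a. x + y \<in> N a) \<and>
     (\<forall>x\<in>N a. \<forall>v\<in>monoms n. \<forall>c. tmul v c x \<in> N (a + int (monom_deg v))))"

lemma graded_moduleD:
  assumes "graded_module n N"
  shows "0 \<in> N a" "x \<in> N a \<Longrightarrow> y \<in> N a \<Longrightarrow> x + y \<in> N a"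
    "x \<in> N a \<Longrightarrow> v \<in> monoms n \<Longrightarrow> b = a + int (monom_deg v) \<Longrightarrow> tmul v c x \<in> N b"
  using assms unfolding graded_module_def by blast+

lemma graded_module_sum:
  "graded_module n N \<Longrightarrow> (\<And>x. x \<in> A \<Longrightarrow> f x \<in> N a) \<Longrightarrow> (\<Sum>x\<in>A. f x) \<in> N a"
  by (induction A rule: infinite_finite_induct) (auto intro: graded_moduleD)

lemma graded_module_subspace: "graded_module n N \<Longrightarrow> vs.subspace (N a)"
  by (rule vs.subspaceI) (auto intro: graded_moduleD)

lemma graded_module_imp_sub: "graded_module n N \<Longrightarrow> graded_sub n N"
  using graded_moduleD(3)[of n N _ _ 0, where c = "- 1"]
  unfolding graded_sub_def var_mult_eq_tmul
  by (auto simp: tmul_uminus intro: graded_moduleD)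

lemma keys_tmul: "keys (tmul v c w k) \<subseteq> (\<lambda>u. u + v) ` keys (w k)"
proof
  fix u assume "u \<in> keys (tmul v c w k)"
  then show "u \<in> (\<lambda>u. u + v) ` keys (w k)"
    using keys_mult[of "single v c" "w k"] unfolding tmul_def
    by (auto split: if_splits simp: add.commute)
qed

lemma graded_module_mono_fam:
  assumes "\<And>k a u v. u \<in> B k a \<Longrightarrow> v \<in> monoms n \<Longrightarrow> u + v \<in> B k (a + int (monom_deg v))"
  shows "graded_module n (mono_fam B :: _ \<Rightarrow> (nat \<Rightarrow> 'k::field mpoly) set)"
  unfolding graded_module_def
proof (intro allI conjI ballI)
  fix a and x :: "nat \<Rightarrow> 'k mpoly" and v c
  assume x: "x \<in> mono_fam B a" and v: "v \<in> monoms n"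
  have "u + v \<in> B k (a + int (monom_deg v))" if "u \<in> keys (x k)" for u k
    using assms[of u k a v] x v that by (auto simp: mono_fam_def)
  then have "keys (tmul v c x k) \<subseteq> B k (a + int (monom_deg v))" for k
    using keys_tmul[of v c x k] by blast
  then show "tmul v c x \<in> mono_fam B (a + int (monom_deg v))"
    by (simp add: mono_fam_def)
next
  fix a and x y :: "nat \<Rightarrow> 'k mpoly"
  assume "x \<in> mono_fam B a" "y \<in> mono_fam B a"
  then show "x + y \<in> mono_fam B a"
    unfolding mono_fam_def plus_fun_apply using keys_add[of "x _" "y _"] by blast
qed (auto simp: mono_fam_def)

lemma graded_module_free: "graded_module n (free_fam n ds)"
  by (rule graded_module_mono_fam) (auto simp: free_pieces_def monom_deg_add)

lemma graded_module_ideal: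
  assumes "\<And>u v. u \<in> A \<Longrightarrow> v \<in> monoms n \<Longrightarrow> u + v \<in> A"
  shows "graded_module n (ideal_fam A)"
  using assms by (intro graded_module_mono_fam) (auto simp: ideal_pieces_def monom_deg_add)

definition mat_map :: "'k::field mpoly mat \<Rightarrow> (nat \<Rightarrow> 'k mpoly) \<Rightarrow> nat \<Rightarrow> 'k mpoly" where
  "mat_map A w = (\<lambda>k. if k < dim_row A then \<Sum>l<dim_col A. A $$ (k, l) * w l else 0)"

lemma mat_map_add: "mat_map A (w + w') = mat_map A w + mat_map A w'"
  by (simp add: mat_map_def fun_eq_iff algebra_simps sum.distrib)

lemma mat_map_tmul: "mat_map A (tmul v c w) = tmul v c (mat_map A w)"
  by (simp add: mat_map_def tmul_def fun_eq_iff sum_distrib_left mult.left_commute)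

lemma hom_of_mat_map [simp]: "hom_of (mat_map A)"
  by (simp add: hom_of_def mat_map_add var_mult_eq_tmul mat_map_tmul)

lemma mat_map_sum: "mat_map A (\<Sum>a\<in>S. g a) = (\<Sum>a\<in>S. mat_map A (g a))"
  by (rule hom_of_sum) simp

lemma graded_module_kernel:
  "graded_module n N \<Longrightarrow> graded_module n (\<lambda>a. {w \<in> N a. mat_map A w = 0})"
  unfolding graded_module_def using hom_of_0[OF hom_of_mat_map[of A]]
  by (auto simp: mat_map_add mat_map_tmul)

lemma keys_sum_subset: "(\<And>a. a \<in> S \<Longrightarrow> keys (f a) \<subseteq> T) \<Longrightarrow> keys (\<Sum>a\<in>S. f a) \<subseteq> T"
proof (induction S rule: infinite_finite_induct)
  case (insert x F)
  have "keys (f x) \<subseteq> T" "keys (sum f F) \<subseteq> T" using insert.IH insert.prems by simp_all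
  then show ?case using keys_add[of "f x" "sum f F"] insert.hyps by auto
qed auto

lemma mat_map_free:
  assumes A: "graded_map n ds es A" and w: "w \<in> free_fam n ds a"
  shows "mat_map A w \<in> free_fam n es a"
  unfolding mono_fam_def
proof (intro CollectI allI)
  fix k
  show "keys (mat_map A w k) \<subseteq> free_pieces n es k a"
  proof (cases "k < length es")
    case True
    have "keys (A $$ (k, l) * w l) \<subseteq> free_pieces n es k a" if l: "l < length ds" for l
    proof
      fix v assume "v \<in> keys (A $$ (k, l) * w l)"
      then obtain b c where bc: "v = b + c" "b \<in> keys (A $$ (k, l))" "c \<in> keys (w l)"
        using keys_mult[of "A $$ (k, l)" "w l"] by blast
      have "keys (A $$ (k, l)) \<subseteq> monoms n" "monom_deg b + es ! k = ds ! l"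
        using A True l bc(2) by (auto simp: graded_map_def poly_ring_def)
      moreover have "c \<in> free_pieces n ds l a" using w bc(3) by (auto simp: mono_fam_def)
      ultimately show "v \<in> free_pieces n es k a"
        using True bc by (auto simp: free_pieces_def monom_deg_add)
    qed
    moreover have "mat_map A w k = (\<Sum>l<length ds. A $$ (k, l) * w l)"
      using True A by (auto simp: mat_map_def graded_map_def)
    ultimately show ?thesis by (simp only:) (rule keys_sum_subset, simp)
  next
    case False
    then show ?thesis using A by (auto simp: mat_map_def graded_map_def)
  qed
qed

text \<open>Minimality is imposed on the kernel of a cover, which makes sense before the next
  differential has been constructed.\<close>

definition minimal_ker :: "nat \<Rightarrow> nat list \<Rightarrow> 'k::field mpoly mat \<Rightarrow> bool" where
  "minimal_ker n ds A \<longleftrightarrow> (\<forall>a. \<forall>w\<in>free_fam n ds a. mat_map A w = 0 \<longrightarrow> (\<forall>k. 0 \<notin> keys (w k)))"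

text \<open>This provides the lifting hypothesis of \<open>vanish_shift\<close> in homological
  degree 0, where a free module has homology spanned by its unit vectors.\<close>

lemma lift_max_ideal:
  assumes c: "c \<in> chain n (free_fam n ds) 0 j" and nz: "\<And>k. 0 \<notin> keys (c {} k)"
  shows "\<exists>g\<in>chain n (free_fam n ds) (Suc 0) j. bd n g = c"
proof -
  \<comment> \<open>The monomial 1 is left out in degree j only. There the entries of c have no
    constant term, whereas dividing a variable in degree j by itself must be allowed to give 1 in
    degree j - 1.\<close>
  define B where "B k a = free_pieces n ds k a - (if a = j then {0} else {})" for k a
  have "vanish n (mono_fam B :: _ \<Rightarrow> (nat \<Rightarrow> 'a mpoly) set) 0 j"
  proof (rule vanish_mono_fam)
    fix k u assume u: "u \<in> B k (j - int 0)" "u \<noteq> 0"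
    then show "u - single (Max (keys u)) 1 \<in> B k (j - int 0 - 1)"
      using monom_deg_diff_single[OF Max_keys_in[OF u(2)]] monoms_diff[of u n]
      by (auto simp: free_pieces_def B_def)
  qed (auto simp: free_pieces_def B_def)
  moreover have "c \<in> chain n (mono_fam B) 0 j"
  proof (rule chainI)
    fix \<tau> :: "nat set" assume \<tau>: "\<tau> \<subseteq> {1..n}" "card \<tau> = 0"
    then have "\<tau> = {}" using finite_subset by fastforce
    then show "c \<tau> \<in> mono_fam B (j - int 0)"
      using chainD[OF c \<tau>] nz by (auto simp: mono_fam_def B_def)
  qed (rule chain_eq_0[OF c])
  ultimately obtain g where g: "g \<in> chain n (mono_fam B) (Suc 0) j" "bd n g = c"
    using bd_chain_0[OF c] unfolding vanish_def by blast
  have "g \<in> chain n (free_fam n ds) (Suc 0) j"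
  proof (rule chainI)
    show "g \<tau> \<in> free_fam n ds (j - int (Suc 0))" if "\<tau> \<subseteq> {1..n}" "card \<tau> = Suc 0" for \<tau>
      using chainD[OF g(1) that] by (auto simp: mono_fam_def B_def)
  qed (rule chain_eq_0[OF g(1)])
  then show ?thesis using g(2) by blast
qed

text \<open>Dimension shifting: passing to the syzygies lowers the homological degree by one and
  keeps the total degree. For p > 0 the lift comes from acyclicity of the free module, for p = 0
  from minimality.\<close>

lemma vanish_image_iff_kernel:
  assumes "minimal_ker n ds A"
  shows "vanish n (\<lambda>a. mat_map A ` free_fam n ds a) (Suc p) j \<longleftrightarrow>
    vanish n (\<lambda>a. {w \<in> free_fam n ds a. mat_map A w = 0}) p j"
proof (rule vanish_shift)
  fix c assume c: "c \<in> chain n (\<lambda>a. {w \<in> free_fam n ds a. mat_map A w = 0}) p j" "bd n c = 0"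
  have cF: "c \<in> chain n (free_fam n ds) p j"
    using chainD[OF c(1)] chain_eq_0[OF c(1)] by (intro chainI) auto
  show "\<exists>g\<in>chain n (free_fam n ds) (Suc p) j. bd n g = c"
  proof (cases p)
    case 0
    have "c {} \<in> free_fam n ds j" "mat_map A (c {}) = 0"
      using chainD[OF c(1), of "{}"] 0 by auto
    then have "0 \<notin> keys (c {} k)" for k using assms unfolding minimal_ker_def by blast
    then show ?thesis using lift_max_ideal cF 0 by blast
  next
    case (Suc p')
    then show ?thesis using cF c(2) vanish_free[of n ds p' j] unfolding vanish_def by blast
  qed
qed (simp_all add: graded_sub_free vanish_free)

text \<open>A form of Nakayama's lemma. If the image of a basis vector were a combination of
  variables times elements of the image, subtracting a lift of that combination would give a syzygy
  with constant term 1.\<close>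

lemma vanish_image_0_iff:
  fixes A :: "'k::field mpoly mat"
  assumes "minimal_ker n ds A"
  shows "vanish n (\<lambda>a. mat_map A ` free_fam n ds a) 0 (int j) \<longleftrightarrow> j \<notin> set ds"
proof
  let ?f = "mat_map A"
  let ?I = "\<lambda>a. ?f ` free_fam n ds a"
  {
    assume v: "vanish n ?I 0 (int j)"
    show "j \<notin> set ds"
    proof
      assume "j \<in> set ds"
      then obtain l where l: "l < length ds" "ds ! l = j" by (auto simp: in_set_conv_nth)
      define e :: "nat \<Rightarrow> 'k mpoly" where "e k = (if k = l then 1 else 0)" for k
      have e: "e \<in> free_fam n ds (int j)"
        using l by (auto simp: e_def mono_fam_def free_pieces_def)
      define c where "c \<tau> = (if \<tau> = {} then ?f e else 0)" for \<tau> :: "nat set"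
      have c: "c \<in> chain n ?I 0 (int j)"
        using e by (intro chainI) (auto simp: c_def dest: finite_subset)
      obtain c' where c': "c' \<in> chain n ?I (Suc 0) (int j)" "bd n c' = c"
        using v c bd_chain_0[OF c] unfolding vanish_def by blast
      obtain g where g: "g \<in> chain n (free_fam n ds) (Suc 0) (int j)" "c' = (\<lambda>\<tau>. ?f (g \<tau>))"
        using chain_image_lift[OF c'(1) hom_of_mat_map] by blast
      have "?f (bd n g {}) = ?f e"
        using fun_cong[OF c'(2), of "{}"] by (simp add: g(2) bd_hom c_def)
      then have "?f (e - bd n g {}) = 0" by (simp only: hom_of_diff[OF hom_of_mat_map] diff_self)
      moreover have "bd n g {} \<in> free_fam n ds (int j)"
        using chainD[OF bd_chain[OF graded_sub_free g(1)], of "{}"] by simp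
      then have "e - bd n g {} \<in> free_fam n ds (int j)"
        using graded_sub_diff[OF graded_sub_free e] by blast
      ultimately have "0 \<notin> keys ((e - bd n g {}) l)"
        using assms unfolding minimal_ker_def by blast
      moreover have "lookup ((e - bd n g {}) l) 0 = 1"
        by (simp add: lookup_minus lookup_bd e_def)
      ultimately show False by (simp add: in_keys_iff)
    qed
  }
  {
    assume j: "j \<notin> set ds"
    show "vanish n ?I 0 (int j)" unfolding vanish_def
    proof (intro ballI impI)
      fix c assume c: "c \<in> chain n ?I 0 (int j)"
      obtain g where g: "g \<in> chain n (free_fam n ds) 0 (int j)" "c = (\<lambda>\<tau>. ?f (g \<tau>))"
        using chain_image_lift[OF c hom_of_mat_map] by blast
      have g0: "g {} \<in> free_fam n ds (int j)" using chainD[OF g(1), of "{}"] by simp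
      have "0 \<notin> keys (g {} k)" for k
      proof
        assume "0 \<in> keys (g {} k)"
        with g0 have "0 \<in> free_pieces n ds k (int j)" by (auto simp: mono_fam_def)
        then show False using j by (auto simp: free_pieces_def)
      qed
      then obtain h where h: "h \<in> chain n (free_fam n ds) (Suc 0) (int j)" "bd n h = g"
        using lift_max_ideal[OF g(1)] by blast
      have "bd n (\<lambda>\<tau>. ?f (h \<tau>)) = c" by (simp add: bd_hom h(2) g(2))
      then show "\<exists>c'\<in>chain n ?I (Suc 0) (int j). bd n c' = c"
        using hom_of_chain[OF hom_of_mat_map h(1)] by blast
    qed
  }
qed

section \<open>Finite generation from vanishing in high degrees\<close>

definition term_span :: "nat \<Rightarrow> (nat \<times> (nat \<Rightarrow> 'k::field mpoly)) set \<Rightarrow> int \<Rightarrow> (nat \<Rightarrow> 'k mpoly) set" where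
  "term_span n B a = vs.span {tmul v 1 g | v d g. (d, g) \<in> B \<and> v \<in> monoms n \<and> int (monom_deg v) + int d = a}"

lemma tmul_term_span:
  assumes "w \<in> term_span n B a" "v \<in> monoms n"
  shows "tmul v c w \<in> term_span n B (a + int (monom_deg v))"
proof -
  let ?T = "{x. tmul v c x \<in> term_span n B (a + int (monom_deg v))}"
  have comm: "tmul v c (tmul 0 d x) = tmul 0 d (tmul v c x)" for d x
    by (simp add: tmul_tmul mult.commute)
  have "vs.subspace ?T"
    by (rule vs.subspaceI)
      (auto simp: term_span_def tmul_add comm intro: vs.span_add vs.span_scale vs.span_zero)
  moreover have "{tmul u 1 g | u d g. (d, g) \<in> B \<and> u \<in> monoms n \<and> int (monom_deg u) + int d = a} \<subseteq> ?T"
  proof clarify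
    fix u d g assume *: "(d, g) \<in> B" "u \<in> monoms n" "a = int (monom_deg u) + int d"
    have "tmul v c (tmul u 1 g) = tmul 0 c (tmul (v + u) 1 g)" by (simp add: tmul_tmul)
    moreover have "tmul (v + u) 1 g \<in> term_span n B (int (monom_deg u) + int d + int (monom_deg v))"
      unfolding term_span_def using * assms(2)
      by (intro vs.span_base CollectI exI[of _ "v + u"] exI[of _ d] exI[of _ g]) (auto simp: monom_deg_add)
    ultimately show "tmul v c (tmul u 1 g) \<in> term_span n B (int (monom_deg u) + int d + int (monom_deg v))"
      unfolding term_span_def by (simp add: vs.span_scale)
  qed
  ultimately have "term_span n B a \<subseteq> ?T" unfolding term_span_def by (intro vs.span_minimal)
  then show ?thesis using assms(1) by blast
qed

lemma graded_module_term_span: "graded_module n (term_span n B)"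
  unfolding graded_module_def
  using tmul_term_span by (auto simp: term_span_def intro: vs.span_zero vs.span_add)

lemma term_span_base: "(d, g) \<in> B \<Longrightarrow> g \<in> term_span n B (int d)"
  unfolding term_span_def
  by (intro vs.span_base CollectI exI[of _ 0] exI[of _ d] exI[of _ g]) simp

lemma term_span_subset:
  assumes "graded_module n N" "\<And>d g. (d, g) \<in> B \<Longrightarrow> g \<in> N (int d)"
  shows "term_span n B a \<subseteq> N a"
  unfolding term_span_def
proof (intro vs.span_minimal graded_module_subspace[OF assms(1)], clarify)
  fix v d g assume "(d, g) \<in> B" "v \<in> monoms n" "a = int (monom_deg v) + int d"
  then show "tmul v 1 g \<in> N (int (monom_deg v) + int d)"
    by (intro graded_moduleD(3)[OF assms(1) assms(2)]) simp_all
qed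

lemma finite_monoms_deg: "finite {v \<in> monoms n. monom_deg v = d}"
proof -
  have "lookup ` {v \<in> monoms n. monom_deg v = d} \<subseteq>
    {f. \<forall>i. (i \<in> {1..n} \<longrightarrow> f i \<in> {0..d}) \<and> (i \<notin> {1..n} \<longrightarrow> f i = 0)}"
  proof clarify
    fix v i assume v: "v \<in> monoms n" "d = monom_deg v"
    have "lookup v i \<le> monom_deg v"
    proof (cases "i \<in> keys v")
      case True
      then show ?thesis unfolding monom_deg_def by (intro member_le_sum) auto
    qed (simp add: in_keys_iff)
    moreover have "i \<notin> {1..n} \<Longrightarrow> lookup v i = 0" using v(1) by (auto simp: monoms_def in_keys_iff)
    ultimately show "(i \<in> {1..n} \<longrightarrow> lookup v i \<in> {0..monom_deg v}) \<and> (i \<notin> {1..n} \<longrightarrow> lookup v i = 0)"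
      by simp
  qed
  then have "finite (lookup ` {v \<in> monoms n. monom_deg v = d})"
    by (rule finite_subset) (intro finite_set_of_finite_funs finite_atLeastAtMost)
  then show ?thesis by (rule finite_imageD) (rule inj_onI, rule poly_mapping_eqI, simp)
qed

lemma finite_spanning_set:
  assumes N: "graded_module n N" "N a \<subseteq> free_fam n es a"
  shows "\<exists>B. finite B \<and> B \<subseteq> N a \<and> N a \<subseteq> vs.span B"
proof -
  define T :: "(nat \<Rightarrow> 'a mpoly) set" where
    "T = (\<lambda>(l, v) k. if k = l then single v 1 else 0) ` (SIGMA l:{..<length es}. free_pieces n es l a)"
  have "free_pieces n es l a \<subseteq> {v \<in> monoms n. monom_deg v = nat (a - int (es ! l))}" for l
    unfolding free_pieces_def by fastforce
  then have "finite (free_pieces n es l a)" for l using finite_monoms_deg finite_subset by blast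
  then have T: "finite T" by (simp add: T_def)
  have "N a \<subseteq> vs.span T"
  proof
    fix w assume "w \<in> N a"
    then have w: "keys (w l) \<subseteq> free_pieces n es l a" for l using N(2) by (auto simp: mono_fam_def)
    let ?b = "\<lambda>l v k. if k = l then single v 1 else (0 :: 'a mpoly)"
    have "w = (\<Sum>l<length es. \<Sum>v\<in>keys (w l). tmul 0 (lookup (w l) v) (?b l v))"
    proof
      fix k
      have "(\<Sum>v\<in>keys (w l). tmul 0 (lookup (w l) v) (?b l v)) k = (if l = k then w l else 0)" for l
      proof (cases "l = k")
        case True
        then show ?thesis
          by (subst (2) mpoly_eq_sum) (simp add: sum_fun_apply tmul_def mult_single)
      qed (simp add: sum_fun_apply tmul_def)
      then have "(\<Sum>l<length es. \<Sum>v\<in>keys (w l). tmul 0 (lookup (w l) v) (?b l v)) k =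
        (if k < length es then w k else 0)"
        by (subst sum_fun_apply) simp
      moreover have "w k = 0" if "\<not> k < length es"
        using w[of k] that by (auto simp: free_pieces_def)
      ultimately show "w k = (\<Sum>l<length es. \<Sum>v\<in>keys (w l). tmul 0 (lookup (w l) v) (?b l v)) k"
        by simp
    qed
    moreover have "?b l v \<in> T" if "l < length es" "v \<in> keys (w l)" for l v
      using w that unfolding T_def by (intro image_eqI[of _ _ "(l, v)"]) auto
    then have "(\<Sum>l<length es. \<Sum>v\<in>keys (w l). tmul 0 (lookup (w l) v) (?b l v)) \<in> vs.span T"
      by (intro vs.span_sum vs.span_scale vs.span_base) simp
    ultimately show "w \<in> vs.span T" by simp
  qed
  moreover obtain B where B: "B \<subseteq> N a" "vs.independent B" "N a \<subseteq> vs.span B"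
    using vs.maximal_independent_subset[of "N a"] by blast
  ultimately have "finite B" using vs.independent_span_bound[OF T B(2)] by blast
  then show ?thesis using B by blast
qed

text \<open>Above b each graded piece is the sum of the x_i times the preceding piece, so the pieces
  of degrees 0 to \<open>nat b\<close> generate N, by induction on the degree. These are
  finite-dimensional, and those of negative degree are zero because N lies in a free module with
  natural degrees.\<close>

lemma finite_generating_set:
  assumes N: "graded_module n N" "\<And>a. N a \<subseteq> free_fam n es a"
    and b: "\<And>j. j > b \<Longrightarrow> vanish n N 0 j"
  shows "\<exists>B. finite B \<and> (\<forall>(d, g)\<in>B. g \<in> N (int d)) \<and> (\<forall>a. term_span n B a = N a)"
proof -
  have "\<forall>a. \<exists>B. finite B \<and> B \<subseteq> N a \<and> N a \<subseteq> vs.span B"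
    using finite_spanning_set[OF N(1) N(2)] by blast
  from choice[OF this] obtain S where S: "\<And>a. finite (S a)" "\<And>a. S a \<subseteq> N a" "\<And>a. N a \<subseteq> vs.span (S a)"
    by blast
  define B where "B = (SIGMA d:{0..nat b}. S (int d))"
  have fin: "finite B" unfolding B_def using S(1) by (intro finite_SigmaI) auto
  have mem: "g \<in> N (int d)" if "(d, g) \<in> B" for d g using that S(2) by (auto simp: B_def)
  have gen: "N (int m) \<subseteq> term_span n B (int m)" for m
  proof (induction m rule: less_induct)
    case (less m)
    show ?case
    proof (cases "m \<le> nat b")
      case True
      have "S (int m) \<subseteq> term_span n B (int m)"
        using True by (auto simp: B_def intro!: term_span_base)
      then show ?thesis
        using S(3)[of "int m"] vs.span_minimal[OF _ graded_module_subspace[OF graded_module_term_span]]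
        by blast
    next
      case False
      then have m: "int m > b" "m > 0" by auto
      show ?thesis
      proof
        fix w assume "w \<in> N (int m)"
        then obtain g where g: "\<forall>i\<in>{1..n}. g i \<in> N (int m - 1)" "w = (\<Sum>i\<in>{1..n}. var_mult i (g i))"
          using b[OF m(1)] vanish_0_iff[OF graded_module_imp_sub[OF N(1)]] by blast
        have "var_mult i (g i) \<in> term_span n B (int m)" if "i \<in> {1..n}" for i
        proof -
          have "g i \<in> term_span n B (int m - 1)"
            using g(1) that less[of "m - 1"] m(2) by (auto simp: of_nat_diff)
          then show ?thesis unfolding var_mult_eq_tmul
            using that by (intro graded_moduleD(3)[OF graded_module_term_span]) auto
        qed
        then show "w \<in> term_span n B (int m)"
          unfolding g(2) by (intro graded_module_sum[OF graded_module_term_span])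
      qed
    qed
  qed
  have "N a \<subseteq> term_span n B a" for a
  proof (cases "a \<ge> 0")
    case True
    then show ?thesis using gen[of "nat a"] by simp
  next
    case False
    have "w = 0" if "w \<in> N a" for w
    proof -
      have "keys (w k) \<subseteq> free_pieces n es k a" for k using that N(2) by (auto simp: mono_fam_def)
      moreover have "free_pieces n es k a = {}" for k using False by (auto simp: free_pieces_def)
      ultimately show ?thesis by (simp add: fun_eq_iff)
    qed
    then show ?thesis using graded_moduleD(1)[OF graded_module_term_span] by blast
  qed
  moreover have "term_span n B a \<subseteq> N a" for a by (rule term_span_subset[OF N(1) mem])
  ultimately show ?thesis using fin mem by (intro exI[of _ B]) auto
qed

text \<open>
  A generating set of least cardinality gives a minimal presentation: a syzygy with a unit
  coefficient would make one generator redundant.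
\<close>

lemma minimal_cover_exists:
  fixes N :: "int \<Rightarrow> (nat \<Rightarrow> 'k::field mpoly) set"
  assumes N: "graded_module n N" "\<And>a. N a \<subseteq> free_fam n es a"
    and b: "\<And>j. j > b \<Longrightarrow> vanish n N 0 j"
  shows "\<exists>ds A. graded_map n ds es A \<and> minimal_ker n ds A \<and> (\<forall>a. mat_map A ` free_fam n ds a = N a)"
proof -
  define P where "P B \<longleftrightarrow> finite B \<and> (\<forall>(d, g)\<in>B. g \<in> N (int d)) \<and> (\<forall>a. term_span n B a = N a)"
    for B :: "(nat \<times> (nat \<Rightarrow> 'k mpoly)) set"
  obtain B where B: "P B" and least: "\<And>B'. P B' \<Longrightarrow> card B \<le> card B'"
    using finite_generating_set[OF N b] ex_has_least_nat[of P _ card] unfolding P_def by metis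
  from B have "finite B" by (simp add: P_def)
  then obtain xs where xs: "set xs = B" "distinct xs" using finite_distinct_list by blast
  define ds where "ds = map fst xs"
  define g where "g l = snd (xs ! l)" for l
  define A where "A = mat (length es) (length xs) (\<lambda>(k, l). g l k)"
  have gB: "(ds ! l, g l) \<in> B" if "l < length xs" for l
    using that xs(1) by (auto simp: ds_def g_def)
  have gN: "g l \<in> N (int (ds ! l))" if "l < length xs" for l
    using gB[OF that] B by (auto simp: P_def)
  have gF: "keys (g l k) \<subseteq> free_pieces n es k (int (ds ! l))" if "l < length xs" for l k
    using gN[OF that] N(2) by (auto simp: mono_fam_def)
  have len: "length ds = length xs" by (simp add: ds_def)
  have A: "graded_map n ds es A"
    using gF by (fastforce simp: graded_map_def A_def len poly_ring_def free_pieces_def)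
  have map_eq: "mat_map A h = (\<Sum>l<length xs. \<Sum>v\<in>keys (h l). tmul v (lookup (h l) v) (g l))" for h
  proof
    fix k
    have "g l k = 0" if "l < length xs" "\<not> k < length es" for l
      using gF[OF that(1), of k] that(2) by (auto simp: free_pieces_def)
    then have "mat_map A h k = (\<Sum>l<length xs. h l * g l k)"
      by (auto simp: mat_map_def A_def mult.commute)
    also have "\<dots> = (\<Sum>l<length xs. (\<Sum>v\<in>keys (h l). tmul v (lookup (h l) v) (g l)) k)"
      by (simp add: mult_eq_sum_tmul[symmetric])
    finally show "mat_map A h k = (\<Sum>l<length xs. \<Sum>v\<in>keys (h l). tmul v (lookup (h l) v) (g l)) k"
      by (simp add: sum_fun_apply)
  qed
  have part: "(\<Sum>v\<in>keys (h l). tmul v (lookup (h l) v) (g l)) \<in> M a"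
    if "h \<in> free_fam n ds a" "graded_module n M" "l < length xs" "g l \<in> M (int (ds ! l))" for h M l a
  proof (intro graded_module_sum[OF that(2)] graded_moduleD(3)[OF that(2,4)])
    fix v assume "v \<in> keys (h l)"
    then have "v \<in> free_pieces n ds l a" using that(1) by (auto simp: mono_fam_def)
    then show "v \<in> monoms n" "a = int (ds ! l) + int (monom_deg v)" by (auto simp: free_pieces_def)
  qed
  have "mat_map A ` free_fam n ds a = N a" for a
  proof
    show "mat_map A ` free_fam n ds a \<subseteq> N a"
    proof (rule image_subsetI)
      fix h :: "nat \<Rightarrow> 'k mpoly" assume h: "h \<in> free_fam n ds a"
      show "mat_map A h \<in> N a" unfolding map_eq
        by (rule graded_module_sum[OF N(1)], rule part[OF h N(1)]) (simp_all add: gN)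
    qed
    have "vs.subspace (mat_map A ` free_fam n ds a)"
    proof (rule vs.subspaceI)
      show "0 \<in> mat_map A ` free_fam n ds a"
        using graded_moduleD(1)[OF graded_module_free] hom_of_0[OF hom_of_mat_map] by (metis imageI)
      fix x y c assume x: "x \<in> mat_map A ` free_fam n ds a"
      show "tmul 0 c x \<in> mat_map A ` free_fam n ds a"
        using x graded_moduleD(3)[OF graded_module_free, of _ n ds a 0 a c]
        by (auto simp: mat_map_tmul[symmetric])
      assume y: "y \<in> mat_map A ` free_fam n ds a"
      show "x + y \<in> mat_map A ` free_fam n ds a"
      proof -
        from x y obtain x' y' where "x' \<in> free_fam n ds a" "y' \<in> free_fam n ds a"
          "x = mat_map A x'" "y = mat_map A y'" by blast
        then show ?thesis
          using graded_moduleD(2)[OF graded_module_free]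
          by (intro image_eqI[of _ _ "x' + y'"]) (simp_all only: mat_map_add)
      qed
    qed
    moreover have "tmul v 1 q \<in> mat_map A ` free_fam n ds a"
      if "(d, q) \<in> B" "v \<in> monoms n" "int (monom_deg v) + int d = a" for v d q
    proof -
      from that(1) xs(1) obtain l where l: "l < length xs" "xs ! l = (d, q)"
        by (auto simp: in_set_conv_nth)
      define h where "h k = (if k = l then single v 1 else (0 :: 'k mpoly))" for k
      have "h \<in> free_fam n ds a"
        using l that by (auto simp: h_def mono_fam_def free_pieces_def len ds_def)
      moreover have "mat_map A h = (\<Sum>k<length xs. if k = l then tmul v 1 (g l) else 0)"
        unfolding map_eq by (intro sum.cong) (auto simp: h_def)
      then have "mat_map A h = tmul v 1 q" using l by (simp add: g_def)
      ultimately show ?thesis by (metis imageI)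
    qed
    ultimately have "term_span n B a \<subseteq> mat_map A ` free_fam n ds a"
      unfolding term_span_def by (intro vs.span_minimal) auto
    then show "N a \<subseteq> mat_map A ` free_fam n ds a" using B by (simp add: P_def)
  qed
  moreover have "minimal_ker n ds A"
    unfolding minimal_ker_def
  proof (intro ballI allI impI notI)
    fix a l and h :: "nat \<Rightarrow> 'k mpoly" assume h: "h \<in> free_fam n ds a" "mat_map A h = 0" "0 \<in> keys (h l)"
    have hl: "keys (h l) \<subseteq> free_pieces n ds l a" using h(1) by (auto simp: mono_fam_def)
    then have l: "l < length xs" "int (ds ! l) = a" using h(3) by (auto simp: free_pieces_def len)
    \<comment> \<open>By homogeneity all monomials of this entry have the same degree, so a constant
      term makes it a nonzero scalar that can be inverted.\<close>
    have "keys (h l) \<subseteq> {0}" using hl l by (auto simp: free_pieces_def)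
    then have kl: "keys (h l) = {0}" using h(3) by blast
    define c where "c = lookup (h l) 0"
    have c: "c \<noteq> 0" using h(3) by (simp add: c_def in_keys_iff)
    define B' where "B' = B - {xs ! l}"
    let ?M = "term_span n B'"
    have M: "graded_module n ?M" by (rule graded_module_term_span)
    let ?R = "\<Sum>k\<in>{..<length xs} - {l}. \<Sum>v\<in>keys (h k). tmul v (lookup (h k) v) (g k)"
    have "0 = (\<Sum>v\<in>keys (h l). tmul v (lookup (h l) v) (g l)) + ?R"
      using h(2) l(1) unfolding map_eq by (simp add: sum.remove[of _ l])
    then have "tmul 0 c (g l) = - ?R" by (simp add: kl c_def eq_neg_iff_add_eq_0)
    moreover have "?R \<in> ?M a"
    proof (rule graded_module_sum[OF M], rule part[OF h(1) M])
      fix k assume k: "k \<in> {..<length xs} - {l}"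
      then show "k < length xs" by simp
      have "xs ! k \<noteq> xs ! l" using k l(1) xs(2) by (simp add: nth_eq_iff_index_eq)
      then have "(ds ! k, g k) \<in> B'"
        using gB[of k] k by (auto simp: B'_def ds_def g_def)
      then show "g k \<in> ?M (int (ds ! k))" by (rule term_span_base)
    qed
    ultimately have "tmul 0 c (g l) \<in> ?M a"
      using graded_subD(3)[OF graded_module_imp_sub[OF M]] by simp
    then have "tmul 0 (1 / c) (tmul 0 c (g l)) \<in> ?M a"
      by (rule graded_moduleD(3)[OF M]) simp_all
    then have gl: "g l \<in> ?M a" using c by (simp add: tmul_tmul)
    have "q \<in> ?M (int d)" if "(d, q) \<in> B" for d q
    proof (cases "(d, q) = xs ! l")
      case True
      then have "d = ds ! l" "q = g l"
        using l(1) by (simp_all add: ds_def g_def) (metis fst_conv snd_conv)+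
      then show ?thesis using gl l(2) by simp
    next
      case False
      then show ?thesis using that by (auto simp: B'_def intro: term_span_base)
    qed
    then have "term_span n B a' \<subseteq> ?M a'" for a' by (rule term_span_subset[OF M])
    moreover have "?M a' \<subseteq> N a'" for a'
      using B by (intro term_span_subset[OF N(1)]) (auto simp: P_def B'_def)
    ultimately have "P B'" using B unfolding P_def by (auto simp: B'_def)
    moreover have "card B' < card B"
      using B xs l(1) unfolding B'_def P_def by (intro psubset_card_mono) auto
    ultimately show False using least[of B'] by simp
  qed
  ultimately show ?thesis using A by blast
qed

section \<open>Ideals and free modules over the polynomial ring\<close>

lemma keys_mult_monoms:
  "keys (f :: 'k::field mpoly) \<subseteq> monoms n \<Longrightarrow> keys g \<subseteq> monoms n \<Longrightarrow> keys (f * g) \<subseteq> monoms n"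
  using keys_mult[of f g] by fastforce

lemma ring_poly_ring: "ring (poly_ring n :: 'k::field mpoly ring)"
proof (rule ringI)
  show "abelian_group (poly_ring n :: 'k mpoly ring)"
  proof (rule abelian_groupI)
    fix x :: "'k mpoly" assume x: "x \<in> carrier (poly_ring n)"
    then show "\<exists>y\<in>carrier (poly_ring n). y \<oplus>\<^bsub>poly_ring n\<^esub> x = \<zero>\<^bsub>poly_ring n\<^esub>"
      by (intro bexI[of _ "- x"]) (simp_all add: poly_ring_def keys_uminus_mpoly)
    fix y :: "'k mpoly" assume "y \<in> carrier (poly_ring n)"
    with x show "x \<oplus>\<^bsub>poly_ring n\<^esub> y \<in> carrier (poly_ring n)"
      using keys_add[of x y] by (auto simp: poly_ring_def)
  qed (simp_all add: poly_ring_def algebra_simps)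
  show "monoid (poly_ring n :: 'k mpoly ring)"
    by (rule monoidI) (simp_all add: poly_ring_def algebra_simps keys_mult_monoms)
qed (simp_all add: poly_ring_def algebra_simps)

lemma a_inv_poly_ring: "f \<in> carrier (poly_ring n) \<Longrightarrow> \<ominus>\<^bsub>poly_ring n\<^esub> f = - (f :: 'k::field mpoly)"
proof -
  interpret ring "poly_ring n :: 'k mpoly ring" by (rule ring_poly_ring)
  assume "f \<in> carrier (poly_ring n)"
  then show ?thesis
    by (intro minus_equality) (simp_all add: poly_ring_def keys_uminus_mpoly)
qed

lemma ideal_poly_ringI:
  assumes "U \<subseteq> monoms n" "\<And>u v. u \<in> U \<Longrightarrow> v \<in> monoms n \<Longrightarrow> u + v \<in> U"
  shows "ideal {f :: 'k::field mpoly. keys f \<subseteq> U} (poly_ring n)"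
proof (rule idealI[OF ring_poly_ring])
  interpret ring "poly_ring n :: 'k mpoly ring" by (rule ring_poly_ring)
  show "subgroup {f :: 'k mpoly. keys f \<subseteq> U} (add_monoid (poly_ring n))"
  proof (rule add.subgroupI)
    show sub: "{f :: 'k mpoly. keys f \<subseteq> U} \<subseteq> carrier (poly_ring n)"
      using assms(1) by (auto simp: poly_ring_def)
    show "{f :: 'k mpoly. keys f \<subseteq> U} \<noteq> {}" by (metis (mono_tags) empty_iff empty_subsetI keys_zero mem_Collect_eq)
    show "\<ominus>\<^bsub>poly_ring n\<^esub> f \<in> {f. keys f \<subseteq> U}" if "f \<in> {f. keys f \<subseteq> U}" for f :: "'k mpoly"
      using that subsetD[OF sub that] by (simp only: a_inv_poly_ring keys_uminus_mpoly mem_Collect_eq)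
    show "f \<oplus>\<^bsub>poly_ring n\<^esub> g \<in> {f. keys f \<subseteq> U}"
      if "f \<in> {f. keys f \<subseteq> U}" "g \<in> {f. keys f \<subseteq> U}" for f g :: "'k mpoly"
      using that keys_add[of f g] by (auto simp: poly_ring_def)
  qed
  have *: "keys (f * g) \<subseteq> U" if "keys f \<subseteq> U" "keys g \<subseteq> monoms n" for f g :: "'k mpoly"
    using keys_mult[of f g] that assms(2) by fastforce
  show "x \<otimes>\<^bsub>poly_ring n\<^esub> a \<in> {f. keys f \<subseteq> U}"
    and "a \<otimes>\<^bsub>poly_ring n\<^esub> x \<in> {f. keys f \<subseteq> U}"
    if "a \<in> {f. keys f \<subseteq> U}" "x \<in> carrier (poly_ring n)" for a x :: "'k mpoly"
    using that *[of a x] by (auto simp: poly_ring_def mult.commute)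
qed

definition up_set :: "nat \<Rightarrow> monom set \<Rightarrow> monom set" where
  "up_set n M = {u + v | u v. u \<in> M \<and> v \<in> monoms n}"

lemma up_set_superset: "M \<subseteq> up_set n M"
  unfolding up_set_def by (metis (mono_tags, lifting) add.right_neutral mem_Collect_eq monoms_0 subsetI)

lemma up_set_add: "u \<in> up_set n M \<Longrightarrow> v \<in> monoms n \<Longrightarrow> u + v \<in> up_set n M"
  unfolding up_set_def by (clarsimp, metis add.assoc monoms_add)

lemma up_set_monoms: "M \<subseteq> monoms n \<Longrightarrow> up_set n M \<subseteq> monoms n"
  by (auto simp: up_set_def)

text \<open>Polynomials supported on the multiples of M form an ideal, and each of their terms is a
  multiple of a generator. An ideal can thus be replaced by the set of its monomials.\<close>

lemma genideal_mon_poly: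
  assumes M: "M \<subseteq> monoms n"
  shows "genideal (poly_ring n) (mon_poly ` M) = {f :: 'k::field mpoly. keys f \<subseteq> up_set n M}"
proof
  interpret ring "poly_ring n :: 'k mpoly ring" by (rule ring_poly_ring)
  have "ideal {f :: 'k mpoly. keys f \<subseteq> up_set n M} (poly_ring n)"
    using up_set_monoms[OF M] up_set_add by (rule ideal_poly_ringI)
  moreover have "mon_poly ` M \<subseteq> {f :: 'k mpoly. keys f \<subseteq> up_set n M}"
    using up_set_superset[of M n] by (auto simp: mon_poly_def)
  ultimately show "genideal (poly_ring n) (mon_poly ` M) \<subseteq> {f :: 'k mpoly. keys f \<subseteq> up_set n M}"
    by (rule genideal_minimal)
  have carr: "mon_poly ` M \<subseteq> carrier (poly_ring n :: 'k mpoly ring)"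
    using M by (auto simp: mon_poly_def poly_ring_def)
  let ?I = "genideal (poly_ring n) (mon_poly ` M) :: 'k mpoly set"
  interpret ideal ?I "poly_ring n" by (rule genideal_ideal[OF carr])
  show "{f :: 'k mpoly. keys f \<subseteq> up_set n M} \<subseteq> ?I"
  proof
    fix f :: "'k mpoly" assume f: "f \<in> {f. keys f \<subseteq> up_set n M}"
    have "single v c \<in> ?I" if "v \<in> up_set n M" for v c
    proof -
      from that obtain u w where uw: "v = w + u" "u \<in> M" "w \<in> monoms n"
        by (auto simp: up_set_def add.commute)
      have "mon_poly u \<in> ?I" using genideal_self[OF carr] uw(2) by blast
      moreover have "single w c \<in> carrier (poly_ring n)" using uw(3) by (simp add: poly_ring_def)
      ultimately have "single w c \<otimes>\<^bsub>poly_ring n\<^esub> mon_poly u \<in> ?I" by (rule I_l_closed)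
      then show ?thesis by (simp add: poly_ring_def mon_poly_def mult_single uw(1))
    qed
    moreover have "(\<Sum>v\<in>S. g v) \<in> ?I" if "finite S" "\<And>v. v \<in> S \<Longrightarrow> g v \<in> ?I" for S and g :: "monom \<Rightarrow> 'k mpoly"
      using that
    proof (induction S rule: finite_induct)
      case empty
      then show ?case using zero_closed by (simp add: poly_ring_def)
    next
      case (insert v S)
      then have "g v \<oplus>\<^bsub>poly_ring n\<^esub> sum g S \<in> ?I" by (intro a_closed) auto
      then show ?case using insert.hyps by (simp add: poly_ring_def)
    qed
    moreover have "v \<in> up_set n M" if "v \<in> keys f" for v using f that by blast
    ultimately have "(\<Sum>v\<in>keys f. single v (lookup f v)) \<in> ?I" by simp
    then show "f \<in> ?I" by (simp only: mpoly_eq_sum[of f, symmetric])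
  qed
qed

lemma up_set_variables: "up_set n ((\<lambda>i. single i 1) ` {1..n}) = monoms n - {0}"
proof
  have "single i 1 + v \<noteq> (0 :: monom)" for i v
    by (metis monom_deg_add monom_deg_eq_0_iff monom_deg_single add_is_0 one_neq_zero)
  then show "up_set n ((\<lambda>i. single i 1) ` {1..n}) \<subseteq> monoms n - {0}"
    by (auto simp: up_set_def)
  show "monoms n - {0} \<subseteq> up_set n ((\<lambda>i. single i 1) ` {1..n})"
  proof
    fix v assume v: "v \<in> monoms n - {0}"
    then obtain i where i: "i \<in> keys v" using keys_eq_empty[of v] by blast
    then have "v = single i 1 + (v - single i 1)" "i \<in> {1..n}"
      using diff_single_add[of i v] v by (auto simp: add.commute monoms_def)
    then show "v \<in> up_set n ((\<lambda>i. single i 1) ` {1..n})"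
      using monoms_diff v unfolding up_set_def by blast
  qed
qed

lemma genideal_variables:
  "genideal (poly_ring n) ((\<lambda>i. mon_poly (single i 1)) ` {1..n}) =
    {f :: 'k::field mpoly. keys f \<subseteq> monoms n - {0}}"
proof -
  have "genideal (poly_ring n) (mon_poly ` (\<lambda>i. single i 1) ` {1..n}) =
    {f :: 'k mpoly. keys f \<subseteq> up_set n ((\<lambda>i. single i 1) ` {1..n})}"
    by (rule genideal_mon_poly) auto
  then show ?thesis by (simp only: up_set_variables image_image)
qed

section \<open>Homogeneous components and degreewise equality of images\<close>

definition part :: "int \<Rightarrow> 'k::field mpoly \<Rightarrow> 'k mpoly" where
  "part c f = (\<Sum>v\<in>keys f. if int (monom_deg v) = c then single v (lookup f v) else 0)"

lemma lookup_part: "lookup (part c f) v = (if int (monom_deg v) = c then lookup f v else 0)"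
proof -
  have "lookup (part c f) v = (\<Sum>u\<in>keys f. if u = v then (if int (monom_deg v) = c then lookup f v else 0) else 0)"
    unfolding part_def lookup_sum by (intro sum.cong) (auto simp: lookup_single when_def)
  also have "\<dots> = (if int (monom_deg v) = c then lookup f v else 0)" by (simp add: in_keys_iff)
  finally show ?thesis .
qed

lemma keys_part: "keys (part c f) = {v \<in> keys f. int (monom_deg v) = c}"
  by (auto simp: in_keys_iff lookup_part split: if_splits)

lemma part_add: "part c (f + g) = part c f + part c g"
  by (intro poly_mapping_eqI) (simp add: lookup_part lookup_add)

lemma part_sum: "part c (\<Sum>a\<in>S. f a) = (\<Sum>a\<in>S. part c (f a))"
  by (intro poly_mapping_eqI) (simp add: lookup_part lookup_sum)

lemma part_mult:
  assumes "\<And>u. u \<in> keys f \<Longrightarrow> int (monom_deg u) = s"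
  shows "part c (f * g) = f * part (c - s) g"
proof -
  let ?g = "g - part (c - s) g"
  have "f * g = f * part (c - s) g + f * ?g" by (simp add: algebra_simps)
  then have "part c (f * g) = part c (f * part (c - s) g) + part c (f * ?g)"
    by (metis part_add)
  moreover have "part c (f * ?g) = 0"
  proof -
    have "int (monom_deg v) \<noteq> c" if v: "v \<in> keys (f * ?g)" for v
    proof -
      obtain a b where "v = a + b" "a \<in> keys f" "b \<in> keys ?g"
        using keys_mult[of f ?g] v by blast
      then show ?thesis using assms[of a]
        by (auto simp: monom_deg_add in_keys_iff lookup_minus lookup_part split: if_splits)
    qed
    then have "keys (part c (f * ?g)) = {}" by (auto simp: keys_part)
    then show ?thesis by simp
  qed
  moreover have "part c (f * part (c - s) g) = f * part (c - s) g"
  proof (rule poly_mapping_eqI)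
    fix v
    have "int (monom_deg v) = c" if v: "v \<in> keys (f * part (c - s) g)"
    proof -
      obtain a b where "v = a + b" "a \<in> keys f" "b \<in> keys (part (c - s) g)"
        using keys_mult[of f "part (c - s) g"] v by blast
      then show ?thesis using assms[of a] by (auto simp: monom_deg_add keys_part)
    qed
    then show "lookup (part c (f * part (c - s) g)) v = lookup (f * part (c - s) g) v"
      by (auto simp: lookup_part in_keys_iff)
  qed
  ultimately show ?thesis by simp
qed

definition comp :: "nat list \<Rightarrow> int \<Rightarrow> (nat \<Rightarrow> 'k::field mpoly) \<Rightarrow> nat \<Rightarrow> 'k mpoly" where
  "comp ds a w = (\<lambda>k. part (a - int (ds ! k)) (w k))"

definition free_set :: "nat \<Rightarrow> nat list \<Rightarrow> (nat \<Rightarrow> 'k::field mpoly) set" where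
  "free_set n ds = {w. \<forall>k. keys (w k) \<subseteq> {v \<in> monoms n. k < length ds}}"

lemma comp_free: "w \<in> free_set n ds \<Longrightarrow> comp ds a w \<in> free_fam n ds a"
  by (fastforce simp: free_set_def mono_fam_def free_pieces_def comp_def keys_part)

lemma free_fam_subset: "free_fam n ds a \<subseteq> free_set n ds"
  by (fastforce simp: free_set_def mono_fam_def free_pieces_def)

lemma free_famD:
  assumes "w \<in> free_fam n ds a" "v \<in> keys (w k)"
  shows "v \<in> monoms n" "k < length ds" "int (monom_deg v) + int (ds ! k) = a"
proof -
  have "v \<in> free_pieces n ds k a" using assms by (auto simp: mono_fam_def)
  then show "v \<in> monoms n" "k < length ds" "int (monom_deg v) + int (ds ! k) = a"
    by (auto simp: free_pieces_def)
qed

lemma comp_ident: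
  assumes "w \<in> free_fam n ds a"
  shows "comp ds a w = w"
proof (intro ext poly_mapping_eqI)
  fix k v
  have "v \<in> keys (w k) \<Longrightarrow> int (monom_deg v) = a - int (ds ! k)"
    using free_famD(3)[OF assms] by fastforce
  then show "lookup (comp ds a w k) v = lookup (w k) v"
    by (auto simp: comp_def lookup_part in_keys_iff)
qed

lemma free_set_eq_sum:
  assumes "w \<in> free_set n ds"
  obtains S where "finite S" "w = (\<Sum>a\<in>S. comp ds a w)"
proof
  let ?S = "\<Union>k<length ds. (\<lambda>v. int (monom_deg v) + int (ds ! k)) ` keys (w k)"
  show fin: "finite ?S" by simp
  show "w = (\<Sum>a\<in>?S. comp ds a w)"
  proof (intro ext poly_mapping_eqI)
    fix k v
    have "lookup ((\<Sum>a\<in>?S. comp ds a w) k) v = (\<Sum>a\<in>?S. if a = int (monom_deg v) + int (ds ! k) then lookup (w k) v else 0)"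
      unfolding sum_fun_apply lookup_sum by (intro sum.cong) (auto simp: comp_def lookup_part)
    also have "\<dots> = (if int (monom_deg v) + int (ds ! k) \<in> ?S then lookup (w k) v else 0)"
      using fin by (simp only: sum.delta)
    also have "\<dots> = lookup (w k) v"
    proof (cases "v \<in> keys (w k)")
      case True
      then have "k < length ds" using assms by (auto simp: free_set_def)
      then show ?thesis using True by auto
    qed (auto simp: in_keys_iff)
    finally show "lookup (w k) v = lookup ((\<Sum>a\<in>?S. comp ds a w) k) v" by simp
  qed
qed

lemma mat_map_comp:
  assumes A: "graded_map n ds es A"
  shows "mat_map A (comp ds a w) = comp es a (mat_map A w)"
proof
  fix k
  have dim: "dim_row A = length es" "dim_col A = length ds" using A by (auto simp: graded_map_def)
  show "mat_map A (comp ds a w) k = comp es a (mat_map A w) k"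
  proof (cases "k < length es")
    case True
    have "part (a - int (es ! k)) (A $$ (k, l) * w l) = A $$ (k, l) * part (a - int (ds ! l)) (w l)"
      if l: "l < length ds" for l
    proof -
      have "part (a - int (es ! k)) (A $$ (k, l) * w l) =
        A $$ (k, l) * part (a - int (es ! k) - (int (ds ! l) - int (es ! k))) (w l)"
      proof (rule part_mult)
        fix u assume "u \<in> keys (A $$ (k, l))"
        then have "monom_deg u + es ! k = ds ! l" using A True l by (simp add: graded_map_def)
        then show "int (monom_deg u) = int (ds ! l) - int (es ! k)" by simp
      qed
      then show ?thesis by simp
    qed
    then show ?thesis using True dim by (simp add: mat_map_def comp_def part_sum)
  next
    case False
    then show ?thesis using dim by (simp add: mat_map_def comp_def part_def)
  qed
qed

text \<open>A resolution is defined through whole modules, whereas the Koszul argument works in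
  graded pieces. A map of degree 0 commutes with taking components, and J contains the components of
  its elements, so the two views agree.\<close>

lemma image_eq_iff_graded:
  assumes A: "graded_map n ds es A" and J: "J \<subseteq> free_set n es"
    and J_comp: "\<And>w a. w \<in> J \<Longrightarrow> comp es a w \<in> J"
    and J_0: "0 \<in> J" and J_add: "\<And>x y. x \<in> J \<Longrightarrow> y \<in> J \<Longrightarrow> x + y \<in> J"
  shows "mat_map A ` free_set n ds = J \<longleftrightarrow> (\<forall>a. mat_map A ` free_fam n ds a = J \<inter> free_fam n es a)"
proof
  assume eq: "mat_map A ` free_set n ds = J"
  show "\<forall>a. mat_map A ` free_fam n ds a = J \<inter> free_fam n es a"
  proof (intro allI equalityI subsetI)
    fix a w assume "w \<in> mat_map A ` free_fam n ds a"
    then show "w \<in> J \<inter> free_fam n es a"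
      using free_fam_subset[of n ds a] mat_map_free[OF A] eq by blast
  next
    fix a w assume w: "w \<in> J \<inter> free_fam n es a"
    then obtain g where g: "g \<in> free_set n ds" "w = mat_map A g" using eq by blast
    have "w = mat_map A (comp ds a g)"
      using comp_ident[of w n es a] w by (simp add: mat_map_comp[OF A] g(2))
    then show "w \<in> mat_map A ` free_fam n ds a" using comp_free[OF g(1)] by blast
  qed
next
  assume eq: "\<forall>a. mat_map A ` free_fam n ds a = J \<inter> free_fam n es a"
  show "mat_map A ` free_set n ds = J"
  proof (intro equalityI subsetI)
    fix w assume "w \<in> mat_map A ` free_set n ds"
    then obtain g where g: "g \<in> free_set n ds" "w = mat_map A g" by blast
    obtain S where S: "finite S" "g = (\<Sum>a\<in>S. comp ds a g)" using free_set_eq_sum[OF g(1)] .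
    have "w = (\<Sum>a\<in>S. mat_map A (comp ds a g))"
      unfolding g(2) by (subst S(2)) (rule mat_map_sum)
    moreover have "mat_map A (comp ds a g) \<in> J" for a using eq comp_free[OF g(1)] by blast
    moreover have "(\<Sum>a\<in>S. h a) \<in> J" if "\<And>a. h a \<in> J" for h
      using that by (induction S rule: infinite_finite_induct) (auto intro: J_0 J_add)
    ultimately show "w \<in> J" by simp
  next
    fix w assume w: "w \<in> J"
    then have wf: "w \<in> free_set n es" using J by blast
    obtain S where S: "finite S" "w = (\<Sum>a\<in>S. comp es a w)" using free_set_eq_sum[OF wf] .
    have "comp es a w \<in> mat_map A ` free_fam n ds a" for a
      using eq J_comp[OF w] comp_free[OF wf] by blast
    then have "\<forall>a. \<exists>g. g \<in> free_set n ds \<and> mat_map A g = comp es a w"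
      using free_fam_subset by (metis (no_types, lifting) imageE subsetD)
    from choice[OF this] obtain g where g: "\<And>a. g a \<in> free_set n ds" "\<And>a. mat_map A (g a) = comp es a w"
      by blast
    have "w = mat_map A (\<Sum>a\<in>S. g a)" by (subst S(2)) (simp add: mat_map_sum g(2))
    moreover have "(\<Sum>a\<in>S. g a) \<in> free_set n ds"
      using g(1) by (auto simp: free_set_def sum_fun_apply intro!: keys_sum_subset)
    ultimately show "w \<in> mat_map A ` free_set n ds" by blast
  qed
qed

text \<open>Padding with zeros carries vectors of every dimension into the common type of functions;
  injectivity holds on each fixed dimension.\<close>

definition vfun :: "'k::field mpoly vec \<Rightarrow> nat \<Rightarrow> 'k mpoly" where
  "vfun w = (\<lambda>k. if k < dim_vec w then w $ k else 0)"

lemma inj_on_vfun: "inj_on vfun (carrier_vec m)"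
proof (rule inj_onI)
  fix x y :: "'a mpoly vec" assume xy: "x \<in> carrier_vec m" "y \<in> carrier_vec m" "vfun x = vfun y"
  have "x $ k = y $ k" if "k < m" for k
    using that fun_cong[OF xy(3), of k] xy(1,2) by (simp add: vfun_def)
  then show "x = y" using xy(1,2) by auto
qed

lemma vfun_image_free: "vfun ` free_module n ds = free_set n ds"
proof (intro equalityI subsetI)
  fix g :: "nat \<Rightarrow> 'a mpoly" assume g: "g \<in> free_set n ds"
  then have gk: "keys (g k) \<subseteq> {v \<in> monoms n. k < length ds}" for k by (simp add: free_set_def)
  have "keys (g k) = {}" if "\<not> k < length ds" for k using gk[of k] that by simp
  then have "g = vfun (vec (length ds) g)" by (auto simp: vfun_def fun_eq_iff)
  moreover have "vec (length ds) g \<in> free_module n ds"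
    using gk by (auto simp: free_module_def poly_ring_def)
  ultimately show "g \<in> vfun ` free_module n ds" by blast
next
  fix g :: "nat \<Rightarrow> 'a mpoly" assume "g \<in> vfun ` free_module n ds"
  then obtain w where w: "w \<in> free_module n ds" "g = vfun w" by blast
  have "keys (w $ k) \<subseteq> monoms n" if "k < length ds" for k
    using w(1) that by (simp add: free_module_def poly_ring_def)
  then show "g \<in> free_set n ds"
    using w by (auto simp: free_module_def free_set_def vfun_def subset_iff)
qed

lemma vfun_mult: "w \<in> carrier_vec (dim_col A) \<Longrightarrow> vfun (A *\<^sub>v w) = mat_map A (vfun w)"
  by (auto simp: vfun_def mat_map_def fun_eq_iff scalar_prod_def lessThan_atLeast0 intro!: sum.cong)

lemma vfun_zero [simp]: "vfun (0\<^sub>v m) = 0"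
  by (auto simp: vfun_def fun_eq_iff)

lemma exact_iff_mat_map:
  assumes A: "A \<in> carrier_mat (length es) (length ds)" and B: "B \<in> carrier_mat m (length es)"
  shows "(\<lambda>w. A *\<^sub>v w) ` free_module n ds = {w \<in> free_module n es. B *\<^sub>v w = 0\<^sub>v (dim_row B)} \<longleftrightarrow>
    mat_map A ` free_set n ds = {w \<in> free_set n es. mat_map B w = 0}"
proof -
  have "vfun ` (\<lambda>w. A *\<^sub>v w) ` free_module n ds = mat_map A ` vfun ` free_module n ds"
    using A by (auto simp: image_image vfun_mult free_module_def intro!: image_cong)
  moreover have "B *\<^sub>v w = 0\<^sub>v (dim_row B) \<longleftrightarrow> mat_map B (vfun w) = 0" if "w \<in> free_module n es" for w
  proof -
    have "B *\<^sub>v w = 0\<^sub>v (dim_row B) \<longleftrightarrow> vfun (B *\<^sub>v w) = vfun (0\<^sub>v (dim_row B))"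
      by (rule inj_on_eq_iff[OF inj_on_vfun[of "dim_row B"], symmetric]) (intro carrier_vecI; simp)+
    moreover have "w \<in> carrier_vec (dim_col B)" using that B by (auto simp: free_module_def)
    ultimately show ?thesis by (simp only: vfun_mult vfun_zero)
  qed
  then have "vfun ` {w \<in> free_module n es. B *\<^sub>v w = 0\<^sub>v (dim_row B)} =
    {w \<in> vfun ` free_module n es. mat_map B w = 0}" by blast
  moreover have "(\<lambda>w. A *\<^sub>v w) ` free_module n ds \<subseteq> carrier_vec (length es)"
    using A by (auto simp: free_module_def)
  then have "(\<lambda>w. A *\<^sub>v w) ` free_module n ds = {w \<in> free_module n es. B *\<^sub>v w = 0\<^sub>v (dim_row B)} \<longleftrightarrow>
    vfun ` (\<lambda>w. A *\<^sub>v w) ` free_module n ds = vfun ` {w \<in> free_module n es. B *\<^sub>v w = 0\<^sub>v (dim_row B)}"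
    by (intro inj_on_image_eq_iff[OF inj_on_vfun, symmetric]) (auto simp: free_module_def)
  ultimately show ?thesis by (simp add: vfun_image_free)
qed

section \<open>Minimal resolutions and regularity of monomial ideals\<close>

definition ideal_set :: "monom set \<Rightarrow> (nat \<Rightarrow> 'k::field mpoly) set" where
  "ideal_set A = {w. keys (w 0) \<subseteq> A \<and> (\<forall>k>0. w k = 0)}"

lemma ideal_set_subset: "A \<subseteq> monoms n \<Longrightarrow> ideal_set A \<subseteq> free_set n [0]"
proof
  fix w :: "nat \<Rightarrow> 'a mpoly" assume A: "A \<subseteq> monoms n" and w: "w \<in> ideal_set A"
  have "keys (w k) \<subseteq> {v \<in> monoms n. k < length [0]}" for k
    using A w by (cases k) (auto simp: ideal_set_def)
  then show "w \<in> free_set n [0]" by (simp add: free_set_def)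
qed

lemma ideal_fam_eq: "A \<subseteq> monoms n \<Longrightarrow> ideal_fam A a = ideal_set A \<inter> free_fam n [0] a"
proof (intro equalityI subsetI IntI)
  fix w :: "nat \<Rightarrow> 'a mpoly" assume A: "A \<subseteq> monoms n"
  {
    assume w: "w \<in> ideal_fam A a"
    then have wk: "keys (w k) \<subseteq> ideal_pieces A k a" for k by (simp add: mono_fam_def)
    have "keys (w k) = {}" if "k > 0" for k using wk[of k] that by (simp add: ideal_pieces_def)
    moreover have "keys (w 0) \<subseteq> A" using wk[of 0] by (auto simp: ideal_pieces_def)
    ultimately show "w \<in> ideal_set A" by (simp add: ideal_set_def)
    have "ideal_pieces A k a \<subseteq> free_pieces n [0] k a" for k
      using A by (auto simp: ideal_pieces_def free_pieces_def)
    then show "w \<in> free_fam n [0] a" using wk by (fastforce simp: mono_fam_def)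
  }
  {
    assume w: "w \<in> ideal_set A \<inter> free_fam n [0] a"
    have "v \<in> ideal_pieces A k a" if v: "v \<in> keys (w k)" for k v
    proof -
      have "k < length [0::nat]" "int (monom_deg v) + int ([0] ! k) = a"
        using free_famD[of w n "[0]" a v k] w v by blast+
      then show ?thesis using w v by (auto simp: ideal_pieces_def ideal_set_def)
    qed
    then show "w \<in> ideal_fam A a" by (auto simp: mono_fam_def)
  }
qed

lemma comp_0 [simp]: "comp ds a 0 = 0"
  by (simp add: comp_def part_def fun_eq_iff)

lemma augmentation_iff:
  assumes B: "graded_map n ds [0] B" and A: "A \<subseteq> monoms n"
  shows "(\<lambda>w. (B *\<^sub>v w) $ 0) ` free_module n ds = {f. keys f \<subseteq> A} \<longleftrightarrow>
    (\<forall>a. mat_map B ` free_fam n ds a = ideal_fam A a)"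
proof -
  have dim: "B \<in> carrier_mat 1 (length ds)" using B by (simp add: graded_map_def)
  have "(B *\<^sub>v w) $ 0 = mat_map B (vfun w) 0" if "w \<in> free_module n ds" for w
  proof -
    have "mat_map B (vfun w) 0 = vfun (B *\<^sub>v w) 0"
      using vfun_mult[of w B] that dim by (simp add: free_module_def)
    then show ?thesis using dim by (simp add: vfun_def)
  qed
  then have "(\<lambda>w. (B *\<^sub>v w) $ 0) ` free_module n ds = (\<lambda>w. mat_map B w 0) ` vfun ` free_module n ds"
    by (simp add: image_image)
  then have "(\<lambda>w. (B *\<^sub>v w) $ 0) ` free_module n ds = (\<lambda>g. g 0) ` mat_map B ` free_set n ds"
    by (simp add: image_image vfun_image_free)
  moreover have "(\<lambda>g. g 0) ` ideal_set A = {f :: 'a mpoly. keys f \<subseteq> A}"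
  proof (intro equalityI subsetI)
    fix f :: "'a mpoly" assume "f \<in> {f. keys f \<subseteq> A}"
    then have "(\<lambda>k. if k = 0 then f else 0) \<in> ideal_set A" by (simp add: ideal_set_def)
    then show "f \<in> (\<lambda>g. g 0) ` ideal_set A" by (intro image_eqI) auto
  qed (auto simp: ideal_set_def)
  moreover have "inj_on (\<lambda>g. g 0) {g :: nat \<Rightarrow> 'a mpoly. \<forall>k>0. g k = 0}"
  proof (rule inj_onI)
    fix x y :: "nat \<Rightarrow> 'a mpoly"
    assume xy: "x \<in> {g. \<forall>k>0. g k = 0}" "y \<in> {g. \<forall>k>0. g k = 0}" "x 0 = y 0"
    have "x k = y k" for k using xy by (cases k) simp_all
    then show "x = y" ..
  qed
  then have "(\<lambda>g. g 0) ` mat_map B ` free_set n ds = (\<lambda>g. g 0) ` ideal_set A \<longleftrightarrow>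
    mat_map B ` free_set n ds = ideal_set A"
    using dim by (intro inj_on_image_eq_iff) (auto simp: ideal_set_def mat_map_def)
  moreover have "mat_map B ` free_set n ds = ideal_set A \<longleftrightarrow>
    (\<forall>a. mat_map B ` free_fam n ds a = ideal_set A \<inter> free_fam n [0] a)"
  proof (rule image_eq_iff_graded[OF B ideal_set_subset[OF A]])
    show "comp [0] a w \<in> ideal_set A" if "w \<in> ideal_set A" for w a
      using that by (auto simp: ideal_set_def comp_def keys_part) (simp add: part_def)
    show "x + y \<in> ideal_set A" if "x \<in> ideal_set A" "y \<in> ideal_set A" for x y
      using that keys_add[of "x 0" "y 0"] by (auto simp: ideal_set_def)
  qed (simp add: ideal_set_def)
  ultimately show ?thesis by (simp add: ideal_fam_eq[OF A])
qed

lemma exact_iff_graded: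
  assumes A: "graded_map n ds es A" and B: "graded_map n es fs B"
  shows "(\<lambda>w. A *\<^sub>v w) ` free_module n ds = {w \<in> free_module n es. B *\<^sub>v w = 0\<^sub>v (dim_row B)} \<longleftrightarrow>
    (\<forall>a. mat_map A ` free_fam n ds a = {w \<in> free_fam n es a. mat_map B w = 0})"
proof -
  have "mat_map A ` free_set n ds = {w \<in> free_set n es. mat_map B w = 0} \<longleftrightarrow>
    (\<forall>a. mat_map A ` free_fam n ds a = {w \<in> free_set n es. mat_map B w = 0} \<inter> free_fam n es a)"
  proof (rule image_eq_iff_graded[OF A])
    show "comp es a w \<in> {w \<in> free_set n es. mat_map B w = 0}"
      if "w \<in> {w \<in> free_set n es. mat_map B w = 0}" for w a
      using that comp_free[of w n es a] free_fam_subset[of n es a] by (auto simp: mat_map_comp[OF B])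
    show "0 \<in> {w \<in> free_set n es. mat_map B w = 0}"
      using hom_of_0[OF hom_of_mat_map[of B]] by (simp add: free_set_def)
    show "x + y \<in> {w \<in> free_set n es. mat_map B w = 0}"
      if "x \<in> {w \<in> free_set n es. mat_map B w = 0}" "y \<in> {w \<in> free_set n es. mat_map B w = 0}" for x y
    proof -
      have "keys ((x + y) k) \<subseteq> {v \<in> monoms n. k < length es}" for k
        using that keys_add[of "x k" "y k"] by (fastforce simp: free_set_def)
      then have "x + y \<in> free_set n es" by (simp add: free_set_def)
      moreover have "mat_map B (x + y) = 0" using that by (simp only: mat_map_add mem_Collect_eq add_0)
      ultimately show ?thesis by blast
    qed
  qed auto
  moreover have "{w \<in> free_set n es. mat_map B w = 0} \<inter> free_fam n es a =
    {w \<in> free_fam n es a. mat_map B w = 0}" for a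
    using free_fam_subset[of n es a] by blast
  moreover have "A \<in> carrier_mat (length es) (length ds)" "B \<in> carrier_mat (length fs) (length es)"
    using A B by (simp_all add: graded_map_def)
  ultimately show ?thesis by (simp only: exact_iff_mat_map)
qed

text \<open>The columns of A generate the kernel of B. If no entry of A has a constant term, neither
  has any combination of the columns; conversely, the columns are themselves homogeneous elements of
  the kernel, as images of unit vectors.\<close>

lemma minimal_iff:
  assumes A: "graded_map n ds es A"
    and image: "\<And>a. mat_map A ` free_fam n ds a = {w \<in> free_fam n es a. mat_map B w = 0}"
  shows "(\<forall>k<length es. \<forall>l<length ds. A $$ (k, l) \<in> genideal (poly_ring n)
      ((\<lambda>i. mon_poly (single i 1)) ` {1..n})) \<longleftrightarrow> minimal_ker n es B"
proof
  have dim: "dim_row A = length es" "dim_col A = length ds" using A by (auto simp: graded_map_def)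
  {
    assume entries: "\<forall>k<length es. \<forall>l<length ds. A $$ (k, l) \<in> genideal (poly_ring n)
      ((\<lambda>i. mon_poly (single i 1)) ` {1..n})"
    show "minimal_ker n es B" unfolding minimal_ker_def
    proof (intro allI ballI impI)
      fix a w k assume w: "w \<in> free_fam n es a" "mat_map B w = 0"
      then have "w \<in> mat_map A ` free_fam n ds a" using image by blast
      then obtain g where g: "w = mat_map A g" by blast
      show "0 \<notin> keys (w k)"
      proof (cases "k < length es")
        case True
        have "keys (A $$ (k, l) * g l) \<subseteq> - {0}" if "l < length ds" for l
        proof -
          have "0 \<notin> keys (A $$ (k, l))"
            using entries True that unfolding genideal_variables by blast
          moreover have "a + b = 0 \<longleftrightarrow> a = 0 \<and> b = (0 :: monom)" for a b
            by (metis add_is_0 monom_deg_add monom_deg_eq_0_iff)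
          ultimately show ?thesis using keys_mult[of "A $$ (k, l)" "g l"] by force
        qed
        then have "keys (\<Sum>l<length ds. A $$ (k, l) * g l) \<subseteq> - {0}"
          by (intro keys_sum_subset) simp
        then show ?thesis using True by (auto simp: g mat_map_def dim)
      qed (simp add: g mat_map_def dim)
    qed
  }
  {
    assume min: "minimal_ker n es B"
    show "\<forall>k<length es. \<forall>l<length ds. A $$ (k, l) \<in> genideal (poly_ring n)
      ((\<lambda>i. mon_poly (single i 1)) ` {1..n})"
    proof (intro allI impI)
      fix k l assume kl: "k < length es" "l < length ds"
      define e :: "nat \<Rightarrow> 'a mpoly" where "e k = (if k = l then 1 else 0)" for k
      have "e \<in> free_fam n ds (int (ds ! l))"
        using kl by (auto simp: e_def mono_fam_def free_pieces_def)
      then have "0 \<notin> keys (mat_map A e k)"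
        using image min unfolding minimal_ker_def by blast
      moreover have "mat_map A e k = (\<Sum>j<length ds. if j = l then A $$ (k, l) else 0)"
        using kl(1) by (auto simp: mat_map_def dim e_def intro!: sum.cong simp del: sum.delta sum.delta')
      moreover have "keys (A $$ (k, l)) \<subseteq> monoms n"
        using A kl by (simp add: graded_map_def poly_ring_def)
      ultimately show "A $$ (k, l) \<in> genideal (poly_ring n) ((\<lambda>i. mon_poly (single i 1)) ` {1..n})"
        using kl(2) unfolding genideal_variables by auto
    qed
  }
qed

lemma minimal_graded_free_resolution_iff:
  assumes A: "A \<subseteq> monoms n"
  shows "minimal_graded_free_resolution n {f :: 'k::field mpoly. keys f \<subseteq> A} d \<phi> \<longleftrightarrow>
    graded_map n (d 0) [0] (\<phi> 0) \<and> (\<forall>p. graded_map n (d (Suc p)) (d p) (\<phi> (Suc p))) \<and>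
    (\<forall>a. mat_map (\<phi> 0) ` free_fam n (d 0) a = ideal_fam A a) \<and>
    (\<forall>p a. mat_map (\<phi> (Suc p)) ` free_fam n (d (Suc p)) a =
      {w \<in> free_fam n (d p) a. mat_map (\<phi> p) w = 0}) \<and>
    (\<forall>p. minimal_ker n (d p) (\<phi> p))"
\<comment> \<open>Exactness and minimality translate to graded pieces only for graded maps; if some
  map is not graded, both sides are false.\<close>
proof (cases "graded_map n (d 0) [0] (\<phi> 0) \<and> (\<forall>p. graded_map n (d (Suc p)) (d p) (\<phi> (Suc p)))")
  case True
  then have g0: "graded_map n (d 0) [0] (\<phi> 0)"
    and g: "graded_map n (d (Suc p)) (d p) (\<phi> (Suc p))" for p by auto
  have exact: "(\<lambda>w. \<phi> (Suc p) *\<^sub>v w) ` free_module n (d (Suc p)) =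
      {w \<in> free_module n (d p). \<phi> p *\<^sub>v w = 0\<^sub>v (dim_row (\<phi> p))} \<longleftrightarrow>
    (\<forall>a. mat_map (\<phi> (Suc p)) ` free_fam n (d (Suc p)) a =
      {w \<in> free_fam n (d p) a. mat_map (\<phi> p) w = 0})" for p
  proof (cases p)
    case 0
    show ?thesis unfolding 0 by (rule exact_iff_graded[OF g g0])
  next
    case (Suc p')
    show ?thesis unfolding Suc by (rule exact_iff_graded[OF g g])
  qed
  have min: "(\<forall>p. \<forall>k<length (d p). \<forall>l<length (d (Suc p)). \<phi> (Suc p) $$ (k, l) \<in>
      genideal (poly_ring n) ((\<lambda>i. mon_poly (single i 1)) ` {1..n})) \<longleftrightarrow>
      (\<forall>p. minimal_ker n (d p) (\<phi> p))"
    if "\<forall>p a. mat_map (\<phi> (Suc p)) ` free_fam n (d (Suc p)) a =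
      {w \<in> free_fam n (d p) a. mat_map (\<phi> p) w = 0}"
  proof (rule iff_allI)
    fix p
    show "(\<forall>k<length (d p). \<forall>l<length (d (Suc p)). \<phi> (Suc p) $$ (k, l) \<in>
      genideal (poly_ring n) ((\<lambda>i. mon_poly (single i 1)) ` {1..n})) \<longleftrightarrow> minimal_ker n (d p) (\<phi> p)"
      by (rule minimal_iff[OF g]) (rule that[THEN spec, THEN spec])
  qed
  show ?thesis
    unfolding minimal_graded_free_resolution_def exact augmentation_iff[OF g0 A]
    by (intro conj_cong refl min)
next
  case False
  then show ?thesis unfolding minimal_graded_free_resolution_def by blast
qed

text \<open>Balancing Tor: the basis degrees of the resolution are read off from Koszul homology.\<close>

lemma resolution_degrees:
  assumes A: "A \<subseteq> monoms n"
    and res: "minimal_graded_free_resolution n {f :: 'k::field mpoly. keys f \<subseteq> A} d \<phi>"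
  shows "j \<in> set (d p) \<longleftrightarrow> \<not> vanish n (ideal_fam A :: _ \<Rightarrow> (nat \<Rightarrow> 'k mpoly) set) p (int j)"
proof -
  let ?Im = "\<lambda>p a. mat_map (\<phi> p) ` free_fam n (d p) a"
  note res = res[unfolded minimal_graded_free_resolution_iff[OF A]]
  have min: "minimal_ker n (d p) (\<phi> p)" for p using res by blast
  have I: "?Im 0 = ideal_fam A" using res by (simp add: fun_eq_iff)
  have N: "(\<lambda>a. {w \<in> free_fam n (d p) a. mat_map (\<phi> p) w = 0}) = ?Im (Suc p)" for p
    using res by (simp add: fun_eq_iff)
  have step: "vanish n (?Im q) (Suc p) i \<longleftrightarrow> vanish n (?Im (Suc q)) p i" for p q i
    using vanish_image_iff_kernel[OF min[of q], of p i] by (simp only: N)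
  \<comment> \<open>Each shift trades one homological degree for one further syzygy module, until
    homological degree 0 exposes the basis degrees.\<close>
  have "vanish n (?Im q) p i \<longleftrightarrow> vanish n (?Im (q + p)) 0 i" for p q i
  proof (induction p arbitrary: q)
    case (Suc p)
    show ?case using step[of q p i] Suc[of "Suc q"] by simp
  qed simp
  from this[of 0 p] have "vanish n (ideal_fam A :: _ \<Rightarrow> (nat \<Rightarrow> 'k mpoly) set) p (int j) \<longleftrightarrow>
    vanish n (?Im p) 0 (int j)"
    by (simp only: I add_0)
  then show ?thesis using vanish_image_0_iff[OF min[of p], of j] by simp
qed

text \<open>The vanishing bound passes from a module to its syzygies, so every syzygy module again
  has a finite minimal cover. Dependent choice strings these covers together.\<close>

lemma minimal_resolution_exists:
  assumes A: "A \<subseteq> monoms n" and up: "\<And>u v. u \<in> A \<Longrightarrow> v \<in> monoms n \<Longrightarrow> u + v \<in> A"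
    and e: "\<And>p j. j > int p + int e \<Longrightarrow> vanish n (ideal_fam A :: _ \<Rightarrow> (nat \<Rightarrow> 'k::field mpoly) set) p j"
  shows "\<exists>d \<phi>. minimal_graded_free_resolution n {f :: 'k mpoly. keys f \<subseteq> A} d \<phi>"
proof -
  define Im :: "nat list \<times> nat list \<times> 'k mpoly mat \<Rightarrow> int \<Rightarrow> (nat \<Rightarrow> 'k mpoly) set" where
    "Im = (\<lambda>(es, ds, B) a. mat_map B ` free_fam n ds a)"
  define Ker :: "nat list \<times> nat list \<times> 'k mpoly mat \<Rightarrow> int \<Rightarrow> (nat \<Rightarrow> 'k mpoly) set" where
    "Ker = (\<lambda>(es, ds, B) a. {w \<in> free_fam n ds a. mat_map B w = 0})"
  \<comment> \<open>After p shifts the homological degree has dropped by p at the same total degree,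
    so the bound q + e becomes q + p + e. The state records the target degrees es as well, to make
    consecutive matrices fit.\<close>
  define P where "P p s \<longleftrightarrow> (case s of (es, ds, B) \<Rightarrow> graded_map n ds es B \<and> minimal_ker n ds B \<and>
    (\<forall>q j. j > int q + int p + int e \<longrightarrow> vanish n (Im s) q j) \<and>
    (p = 0 \<longrightarrow> es = [0] \<and> Im s = ideal_fam A))" for p s
  define Q where "Q s s' \<longleftrightarrow> fst s' = fst (snd s) \<and> Im s' = Ker s" for s s'
  have "\<exists>f. \<forall>p. P p (f p) \<and> Q (f p) (f (Suc p))"
  proof (rule dependent_nat_choice)
    have mod: "graded_module n (ideal_fam A :: _ \<Rightarrow> (nat \<Rightarrow> 'k mpoly) set)"
      by (rule graded_module_ideal[OF up])
    have "ideal_fam A a \<subseteq> (free_fam n [0] a :: (nat \<Rightarrow> 'k mpoly) set)" for a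
      unfolding ideal_fam_eq[OF A] by blast
    moreover have "vanish n (ideal_fam A :: _ \<Rightarrow> (nat \<Rightarrow> 'k mpoly) set) 0 j" if "j > int e" for j
      by (rule e) (use that in simp)
    ultimately obtain ds and B :: "'k mpoly mat" where *: "graded_map n ds [0] B" "minimal_ker n ds B"
      "\<forall>a. mat_map B ` free_fam n ds a = ideal_fam A a"
      using minimal_cover_exists[OF mod, where es = "[0]" and b = "int e"] by blast
    then have "Im ([0], ds, B) = ideal_fam A" by (simp add: Im_def fun_eq_iff)
    then have "P 0 ([0], ds, B)" using * e by (simp add: P_def)
    then show "\<exists>s. P 0 s" ..
  next
    fix s p assume P: "P p s"
    obtain es ds B where s: "s = (es, ds, B)" by (cases s)
    have min: "minimal_ker n ds B" using P by (simp add: P_def s)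
    have van: "vanish n (Ker s) q j" if "j > int q + int (Suc p) + int e" for q j
    proof -
      have "vanish n (Im s) (Suc q) j" using P that by (auto simp: P_def s)
      then show ?thesis using vanish_image_iff_kernel[OF min] by (simp add: Im_def Ker_def s)
    qed
    have mod: "graded_module n (Ker s)"
      unfolding Ker_def s prod.case by (rule graded_module_kernel[OF graded_module_free])
    have "Ker s a \<subseteq> free_fam n ds a" for a by (auto simp: Ker_def s)
    moreover have "vanish n (Ker s) 0 j" if "j > int (Suc p) + int e" for j
      by (rule van) (use that in simp)
    ultimately obtain ds' and B' :: "'k mpoly mat" where *: "graded_map n ds' ds B'" "minimal_ker n ds' B'"
      "\<forall>a. mat_map B' ` free_fam n ds' a = Ker s a"
      using minimal_cover_exists[OF mod, where es = ds and b = "int (Suc p) + int e"] by blast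
    then have im: "Im (ds, ds', B') = Ker s" by (simp add: Im_def fun_eq_iff)
    have "P (Suc p) (ds, ds', B')" using * van by (simp add: P_def im)
    moreover have "Q s (ds, ds', B')" by (simp add: Q_def im s)
    ultimately show "\<exists>s'. P (Suc p) s' \<and> Q s s'" by blast
  qed
  then obtain f where f: "\<And>p. P p (f p)" "\<And>p. Q (f p) (f (Suc p))" by blast
  define d where "d p = fst (snd (f p))" for p
  define \<phi> where "\<phi> p = snd (snd (f p))" for p
  have fp: "f p = (fst (f p), d p, \<phi> p)" for p by (simp add: d_def \<phi>_def)
  have Imf: "Im (f p) a = mat_map (\<phi> p) ` free_fam n (d p) a" for p a
    by (subst fp) (simp add: Im_def)
  have Kerf: "Ker (f p) a = {w \<in> free_fam n (d p) a. mat_map (\<phi> p) w = 0}" for p a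
    by (subst fp) (simp add: Ker_def)
  have Pf: "graded_map n (d p) (fst (f p)) (\<phi> p) \<and> minimal_ker n (d p) (\<phi> p) \<and>
      (p = 0 \<longrightarrow> fst (f p) = [0] \<and> Im (f p) = ideal_fam A)" for p
    using f(1)[of p] unfolding P_def by (subst (asm) (2) fp) simp
  have Qf: "fst (f (Suc p)) = d p" "Im (f (Suc p)) = Ker (f p)" for p
    using f(2)[of p] by (simp_all add: Q_def d_def)
  have "graded_map n (d 0) [0] (\<phi> 0)" using Pf[of 0] by auto
  moreover have "graded_map n (d (Suc p)) (d p) (\<phi> (Suc p))" for p
    using Pf[of "Suc p"] Qf(1)[of p] by auto
  moreover have "mat_map (\<phi> 0) ` free_fam n (d 0) a = ideal_fam A a" for a
    using Pf[of 0] Imf[of 0 a] by simp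
  moreover have "mat_map (\<phi> (Suc p)) ` free_fam n (d (Suc p)) a =
      {w \<in> free_fam n (d p) a. mat_map (\<phi> p) w = 0}" for p a
    using Qf(2)[of p] Imf[of "Suc p" a] Kerf[of p a] by simp
  moreover have "minimal_ker n (d p) (\<phi> p)" for p using Pf by blast
  ultimately show ?thesis unfolding minimal_graded_free_resolution_iff[OF A] by blast
qed

theorem reg_monomial_ideal:
  assumes A: "A \<subseteq> monoms n" and up: "\<And>u v. u \<in> A \<Longrightarrow> v \<in> monoms n \<Longrightarrow> u + v \<in> A"
    and above: "\<And>u. u \<in> A \<Longrightarrow> monom_deg u > e \<Longrightarrow> u - single (Max (keys u)) 1 \<in> A"
    and w: "w \<in> A" "w \<noteq> 0" "monom_deg w = e" "w - single (Max (keys w)) 1 \<notin> A"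
  shows "reg n {f :: 'k::field mpoly. keys f \<subseteq> A} = int e"
proof -
  let ?I = "{f :: 'k mpoly. keys f \<subseteq> A}"
  let ?V = "\<lambda>p j. vanish n (ideal_fam A :: _ \<Rightarrow> (nat \<Rightarrow> 'k mpoly) set) p j"
  define d where "d = (SOME d. \<exists>\<phi>. minimal_graded_free_resolution n ?I d \<phi>)"
  have van: "?V p j" if "j > int p + int e" for p j
    by (rule vanish_ideal_above[OF A above that])
  have "\<exists>d \<phi>. minimal_graded_free_resolution n ?I d \<phi>"
    using minimal_resolution_exists[OF A up van] by blast
  then have "\<exists>\<phi>. minimal_graded_free_resolution n ?I d \<phi>"
    unfolding d_def by (rule someI_ex)
  then obtain \<phi> where "minimal_graded_free_resolution n ?I d \<phi>" ..
  note deg = resolution_degrees[OF A this]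
  have betti: "betti n ?I p j \<noteq> 0 \<longleftrightarrow> \<not> ?V p (int j)" for p j
    unfolding betti_def d_def[symmetric] deg[symmetric] by (simp add: count_list_0_iff)
  let ?S = "{int j - int p | p j. betti n ?I p j \<noteq> 0}"
  \<comment> \<open>Both bounds together make the set finite, so that its \<open>Max\<close> is
    meaningful.\<close>
  have bounds: "0 \<le> x \<and> x \<le> int e" if "x \<in> ?S" for x
  proof -
    from that obtain p j where x: "x = int j - int p" "\<not> ?V p (int j)" unfolding betti by blast
    then have "\<not> int j < int p" using vanish_ideal_below by blast
    moreover have "\<not> int j > int p + int e" using van x(2) by blast
    ultimately show ?thesis using x(1) by simp
  qed
  then have "?S \<subseteq> {0..int e}" by (simp only: subset_iff atLeastAtMost_iff) blast
  then have fin: "finite ?S" by (rule finite_subset) simp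
  let ?m = "Max (keys w)"
  have wm: "?m \<in> keys w" by (rule Max_keys_in[OF w(2)])
  \<comment> \<open>The product w x_i has degree e + 1 and still has last variable x_m, so
    \<open>above\<close> permits the division by x_m. These monomials are the coefficients of the
    cycle.\<close>
  have "w - single ?m 1 + single i 1 \<in> A" if i: "i \<in> {1..?m}" for i
  proof -
    let ?u = "w - single ?m 1 + single i 1"
    let ?z = "w + single i 1"
    have i_n: "i \<in> {1..n}"
    proof -
      have "keys w \<subseteq> {1..n}" using w(1) A by (auto simp: monoms_def)
      then have "?m \<le> n" using wm by auto
      then show ?thesis using i by auto
    qed
    have "Max (keys ?z) = ?m"
      using i wm by (intro Max_eqI) (auto simp: keys_add_nat)
    moreover have "?z \<in> A" using up[OF w(1)] i_n by simp
    moreover have "monom_deg ?z > e" by (simp add: monom_deg_add w(3))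
    ultimately have "?z - single ?m 1 \<in> A" using above[of ?z] by simp
    moreover have "?z - single ?m 1 = ?u"
      using wm by (intro poly_mapping_eqI)
        (auto simp: lookup_add lookup_minus lookup_single when_def in_keys_iff)
    ultimately show ?thesis by simp
  qed
  then have "\<not> ?V (?m - 1) (int (monom_deg w) + int (?m - 1))"
    by (rule not_vanish_ideal[OF A w(1,2,4)])
  then have "betti n ?I (?m - 1) (monom_deg w + (?m - 1)) \<noteq> 0" unfolding betti by simp
  moreover have "int e = int (monom_deg w + (?m - 1)) - int (?m - 1)" using w(3) by simp
  ultimately have "int e \<in> ?S" by blast
  then show ?thesis unfolding reg_def using bounds by (intro Max_eqI[OF fin]) blast+
qed

section \<open>Principal ideals of strong Borel type\<close>

lemma monomial_ideal_iff:
  "monomial_ideal n (I :: 'k::field mpoly set) \<longleftrightarrow> (\<exists>M\<subseteq>monoms n. I = {f. keys f \<subseteq> up_set n M})"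
  unfolding monomial_ideal_def using genideal_mon_poly by blast

lemma mon_poly_mem_iff: "mon_poly v \<in> {f :: 'k::field mpoly. keys f \<subseteq> U} \<longleftrightarrow> v \<in> U"
  by (simp add: mon_poly_def)

section \<open>Borel moves\<close>

text \<open>The substitution of x_j for x_i, which is the move with the largest admissible exponent
  t.\<close>

definition move :: "nat \<Rightarrow> nat \<Rightarrow> monom \<Rightarrow> monom" where
  "move i j v = v - single i (lookup v i) + single j (lookup v i)"

lemma lookup_move:
  "i \<noteq> j \<Longrightarrow> lookup (move i j v) k = (if k = i then 0 else if k = j then lookup v j + lookup v i else lookup v k)"
  by (simp add: move_def lookup_add lookup_minus lookup_single when_def)

lemma move_add: "i \<noteq> j \<Longrightarrow> move i j (v + w) = move i j v + move i j w"
  by (intro poly_mapping_eqI) (simp add: lookup_move lookup_add)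

lemma move_single: "i \<noteq> j \<Longrightarrow> move i j (single c a) = single (if c = i then j else c) a"
  by (intro poly_mapping_eqI) (auto simp: lookup_move lookup_single when_def)

lemma move_0: "i \<noteq> j \<Longrightarrow> move i j 0 = 0"
  by (intro poly_mapping_eqI) (simp add: lookup_move)

lemma move_sum: "i \<noteq> j \<Longrightarrow> move i j (\<Sum>q\<in>S. f q) = (\<Sum>q\<in>S. move i j (f q))"
  by (induction S rule: infinite_finite_induct) (auto simp: move_add move_0)

lemma move_monoms: "v \<in> monoms n \<Longrightarrow> j \<in> {1..n} \<Longrightarrow> move i j v \<in> monoms n"
  unfolding move_def by (simp add: monoms_diff)

text \<open>Multiplying by the missing power of x_j turns any admissible t into the full exponent,
  so only complete substitutions have to be followed.\<close>

lemma move_mem_if_le: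
  assumes "v - single i (lookup v i) + single j t \<in> up_set n M" "t \<le> lookup v i" "j \<in> {1..n}"
  shows "move i j v \<in> up_set n M"
proof -
  have "move i j v = v - single i (lookup v i) + single j t + single j (lookup v i - t)"
    using assms(2) by (simp add: move_def add.assoc single_add[symmetric])
  then show ?thesis using assms(1,3) by (auto intro: up_set_add)
qed

locale sbt_exponents =
  fixes n r :: nat and i \<alpha> :: "nat \<Rightarrow> nat"
  assumes r: "r \<ge> 1"
    and i_range: "i ` {1..r} \<subseteq> {1..n}"
    and i_mono: "strict_mono_on {1..r} i"
    and \<alpha>_pos: "\<forall>q\<in>{1..r}. \<alpha> q > 0"
    and \<alpha>_anti: "antimono_on {1..r} \<alpha>"
begin

text \<open>
  The monomials of the product ideal
  \<open>(x\<^sub>1\<^sup>\<alpha>\<^sup>1, \<dots>, x\<^bsub>i 1\<^esub>\<^sup>\<alpha>\<^sup>1) \<cdots> (x\<^sub>1\<^sup>\<alpha>\<^sup>t, \<dots>, x\<^bsub>i t\<^esub>\<^sup>\<alpha>\<^sup>t)\<close>; for \<open>t = r\<close> this is \<open>SBT(u)\<close>.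
\<close>

definition gens :: "nat \<Rightarrow> monom set" where
  "gens t = {\<Sum>q = 1..t. single (c q) (\<alpha> q) | c. \<forall>q\<in>{1..t}. c q \<in> {1..i q}}"

definition prod_mons :: "nat \<Rightarrow> monom set" where
  "prod_mons t = up_set n (gens t)"

lemma i_mem: "q \<in> {1..r} \<Longrightarrow> i q \<in> {1..n}"
  using i_range by blast

lemma i_less: "p \<in> {1..r} \<Longrightarrow> q \<in> {1..r} \<Longrightarrow> p < q \<Longrightarrow> i p < i q"
  using i_mono by (simp add: strict_mono_on_def)

lemma i_le: "p \<in> {1..r} \<Longrightarrow> q \<in> {1..r} \<Longrightarrow> p \<le> q \<Longrightarrow> i p \<le> i q"
  using i_less[of p q] by (cases "p = q") auto

lemma \<alpha>_le: "p \<in> {1..r} \<Longrightarrow> q \<in> {1..r} \<Longrightarrow> p \<le> q \<Longrightarrow> \<alpha> q \<le> \<alpha> p"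
  using \<alpha>_anti by (simp add: monotone_on_def)

lemma sum_single_monoms:
  assumes "t \<le> r" "\<forall>q\<in>{1..t}. c q \<in> {1..i q}"
  shows "(\<Sum>q = 1..t. single (c q) (a q)) \<in> monoms n"
proof -
  have "keys (\<Sum>q = 1..t. single (c q) (a q)) \<subseteq> {1..n}"
  proof (rule keys_sum_subset)
    fix q assume q: "q \<in> {1..t}"
    then have "c q \<in> {1..i q}" "i q \<in> {1..n}" using assms i_mem[of q] by auto
    then show "keys (single (c q) (a q)) \<subseteq> {1..n}" by auto
  qed
  then show ?thesis by (simp add: monoms_def)
qed

lemma gens_monoms: "t \<le> r \<Longrightarrow> gens t \<subseteq> monoms n"
  using sum_single_monoms by (auto simp: gens_def)

lemma prod_monsE:
  assumes "v \<in> prod_mons t"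
  obtains c w where "\<forall>q\<in>{1..t}. c q \<in> {1..i q}" "w \<in> monoms n"
    "v = (\<Sum>q = 1..t. single (c q) (\<alpha> q)) + w"
  using assms unfolding prod_mons_def up_set_def gens_def by blast

lemma prod_monsI:
  "\<forall>q\<in>{1..t}. c q \<in> {1..i q} \<Longrightarrow> w \<in> monoms n \<Longrightarrow> (\<Sum>q = 1..t. single (c q) (\<alpha> q)) + w \<in> prod_mons t"
  unfolding prod_mons_def up_set_def gens_def by blast

lemma prod_mons_monoms: "t \<le> r \<Longrightarrow> prod_mons t \<subseteq> monoms n"
  unfolding prod_mons_def by (intro up_set_monoms gens_monoms)

lemma sum_split:
  "s \<le> t \<Longrightarrow> (\<Sum>q = 1..t. f q) = (\<Sum>q = 1..s. f q) + (\<Sum>q = Suc s..t. f q :: monom)"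
  using sum.ub_add_nat[of 1 s f "t - s"] by simp

lemma prod_mons_antimono:
  assumes "s \<le> t" "t \<le> r"
  shows "prod_mons t \<subseteq> prod_mons s"
proof
  fix v assume "v \<in> prod_mons t"
  then obtain c w where c: "\<forall>q\<in>{1..t}. c q \<in> {1..i q}" "w \<in> monoms n"
    "v = (\<Sum>q = 1..t. single (c q) (\<alpha> q)) + w" by (rule prod_monsE)
  have "(\<Sum>q = 1..t. single (c q) (\<alpha> q)) \<in> monoms n" using assms(2) c(1) by (rule sum_single_monoms)
  then have "(\<Sum>q = Suc s..t. single (c q) (\<alpha> q)) \<in> monoms n"
    unfolding sum_split[OF assms(1)] by simp
  moreover have "v = (\<Sum>q = 1..s. single (c q) (\<alpha> q)) + ((\<Sum>q = Suc s..t. single (c q) (\<alpha> q)) + w)"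
    unfolding c(3) sum_split[OF assms(1)] by (simp add: add.assoc)
  ultimately show "v \<in> prod_mons s"
    using prod_monsI[of s c "(\<Sum>q = Suc s..t. single (c q) (\<alpha> q)) + w"] c(1,2) assms(1) by auto
qed

text \<open>Substitution is multiplicative, and replacing a chosen index l by a smaller k preserves
  c q <= i q, so generators go to generators.\<close>

lemma move_prod_mons:
  assumes "v \<in> prod_mons r" "1 \<le> k" "k < l" "l \<le> n"
  shows "move l k v \<in> prod_mons r"
proof -
  from assms(1) obtain c w where c: "\<forall>q\<in>{1..r}. c q \<in> {1..i q}" "w \<in> monoms n"
    "v = (\<Sum>q = 1..r. single (c q) (\<alpha> q)) + w" by (rule prod_monsE)
  let ?c = "\<lambda>q. if c q = l then k else c q"
  have "move l k v = (\<Sum>q = 1..r. single (?c q) (\<alpha> q)) + move l k w"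
    using assms(3) by (simp add: c(3) move_add move_sum move_single)
  moreover have "\<forall>q\<in>{1..r}. ?c q \<in> {1..i q}" using c(1) assms(2,3) by fastforce
  moreover have "move l k w \<in> monoms n" using c(2) assms by (intro move_monoms) auto
  ultimately show ?thesis by (simp only: prod_monsI)
qed

lemma strong_borel_type_prod: "strong_borel_type n {f :: 'k::field mpoly. keys f \<subseteq> prod_mons r}"
  unfolding strong_borel_type_def mon_poly_mem_iff
proof (intro conjI ballI impI allI)
  show "monomial_ideal n {f :: 'k mpoly. keys f \<subseteq> prod_mons r}"
    unfolding monomial_ideal_iff prod_mons_def using gens_monoms by blast
  fix v l k assume "v \<in> monoms n" "v \<in> prod_mons r" "1 \<le> k \<and> k < l \<and> l \<le> n"
  then show "\<exists>t\<le>lookup v l. v - single l (lookup v l) + single k t \<in> prod_mons r"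
    using move_prod_mons[of v k l] unfolding move_def by (intro exI[of _ "lookup v l"]) simp
qed

text \<open>Starting from u, the factors are moved to their places one at a time in the order of
  increasing i_q, so that no move disturbs another factor.\<close>

lemma gens_in_strong_borel_type:
  assumes I: "strong_borel_type n {f :: 'k::field mpoly. keys f \<subseteq> up_set n M}"
    and M: "M \<subseteq> monoms n" and u: "(\<Sum>q = 1..r. single (i q) (\<alpha> q)) \<in> up_set n M"
    and c: "\<forall>q\<in>{1..r}. c q \<in> {1..i q}"
  shows "(\<Sum>q = 1..r. single (c q) (\<alpha> q)) \<in> up_set n M"
proof -
  define x where "x t q = (if q \<le> t then c q else i q)" for t q
  have "t \<le> r \<Longrightarrow> (\<Sum>q = 1..r. single (x t q) (\<alpha> q)) \<in> up_set n M" for t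
  proof (induction t)
    case 0
    have "(\<Sum>q = 1..r. single (x 0 q) (\<alpha> q)) = (\<Sum>q = 1..r. single (i q) (\<alpha> q))"
      by (intro sum.cong) (auto simp: x_def)
    then show ?case using u by simp
  next
    case (Suc t)
    let ?v = "\<Sum>q = 1..r. single (x t q) (\<alpha> q)" and ?l = "i (Suc t)" and ?k = "c (Suc t)"
    have v: "?v \<in> up_set n M" using Suc by simp
    have t: "Suc t \<in> {1..r}" using Suc.prems by simp
    have k: "?k \<in> {1..?l}" using c t by blast
    \<comment> \<open>Factors already moved lie at most at i q < \<open>?l\<close>, and later ones
      still lie beyond \<open>?l\<close>. So only the factor \<open>Suc t\<close> is at
      \<open>?l\<close>, and the move affects it alone.\<close>
    have x_eq: "x t q = ?l \<longleftrightarrow> q = Suc t" if q: "q \<in> {1..r}" for q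
    proof (cases "q \<le> t")
      case True
      then have "c q \<le> i q" "i q < ?l" using c q i_less[OF q t] by auto
      then show ?thesis using True by (simp add: x_def)
    next
      case False
      then show ?thesis using i_less[OF t q] by (cases "q = Suc t") (auto simp: x_def)
    qed
    show ?case
    proof (cases "?k = ?l")
      case True
      then have "x (Suc t) = x t" by (auto simp: x_def fun_eq_iff le_Suc_eq)
      then show ?thesis using v by simp
    next
      case False
      then have kl: "1 \<le> ?k" "?k < ?l" "?l \<le> n" using k i_mem[OF t] by auto
      have "?v \<in> monoms n" using v up_set_monoms[OF M] by blast
      then obtain s where "s \<le> lookup ?v ?l" "?v - single ?l (lookup ?v ?l) + single ?k s \<in> up_set n M"
        using I v kl unfolding strong_borel_type_def mon_poly_mem_iff by blast
      then have "move ?l ?k ?v \<in> up_set n M"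
        using kl by (intro move_mem_if_le) auto
      moreover have "move ?l ?k ?v = (\<Sum>q = 1..r. single (x (Suc t) q) (\<alpha> q))"
        using False x_eq by (simp add: move_sum move_single) (intro sum.cong, auto simp: x_def le_Suc_eq)
      ultimately show ?thesis by simp
    qed
  qed
  from this[of r] have "(\<Sum>q = 1..r. single (x r q) (\<alpha> q)) \<in> up_set n M" by simp
  moreover have "(\<Sum>q = 1..r. single (x r q) (\<alpha> q)) = (\<Sum>q = 1..r. single (c q) (\<alpha> q))"
    by (intro sum.cong) (auto simp: x_def)
  ultimately show ?thesis by simp
qed

lemma principal_SBT_eq:
  "principal_SBT n (\<Sum>q = 1..r. single (i q) (\<alpha> q)) = {f :: 'k::field mpoly. keys f \<subseteq> prod_mons r}"
  unfolding principal_SBT_def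
proof (rule Least_equality, intro conjI strong_borel_type_prod)
  have "(\<Sum>q = 1..r. single (i q) (\<alpha> q)) + 0 \<in> prod_mons r"
    by (rule prod_monsI) (use i_mem in auto)
  then show "mon_poly (\<Sum>q = 1..r. single (i q) (\<alpha> q)) \<in> {f :: 'k mpoly. keys f \<subseteq> prod_mons r}"
    unfolding mon_poly_mem_iff by simp
next
  fix I :: "'k mpoly set"
  assume I: "strong_borel_type n I \<and> mon_poly (\<Sum>q = 1..r. single (i q) (\<alpha> q)) \<in> I"
  then obtain M where M: "M \<subseteq> monoms n" "I = {f. keys f \<subseteq> up_set n M}"
    unfolding strong_borel_type_def monomial_ideal_iff by blast
  have "gens r \<subseteq> up_set n M"
    using gens_in_strong_borel_type[OF _ M(1)] I unfolding M(2) mon_poly_mem_iff gens_def by blast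
  then have "prod_mons r \<subseteq> up_set n M"
    unfolding prod_mons_def by (auto simp: up_set_def[of n "gens r"] intro: up_set_add)
  then show "{f. keys f \<subseteq> prod_mons r} \<subseteq> I" unfolding M(2) by blast
qed

section \<open>Degrees at which monomials leave the product\<close>

definition \<chi> :: "nat \<Rightarrow> nat" where
  "\<chi> q = (\<Sum>s = 1..<q. \<alpha> s) + (\<alpha> q - 1) * i q"

lemma monom_deg_sum: "monom_deg (\<Sum>q\<in>S. f q) = (\<Sum>q\<in>S. monom_deg (f q))"
  by (induction S rule: infinite_finite_induct) (auto simp: monom_deg_add)

text \<open>Pigeonhole: a cofactor of large degree is divisible by some \<open>x\<^sub>j\<^sup>\<alpha>\<^sup>t\<close>.\<close>

lemma deg_le_\<chi>:
  assumes t: "t \<in> {1..r}" and v: "v \<in> prod_mons (t - 1)" "v \<notin> prod_mons t" "keys v \<subseteq> {1..i t}"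
  shows "monom_deg v \<le> \<chi> t"
proof -
  from v(1) obtain c w where c: "\<forall>q\<in>{1..t - 1}. c q \<in> {1..i q}" "w \<in> monoms n"
    "v = (\<Sum>q = 1..t - 1. single (c q) (\<alpha> q)) + w" by (rule prod_monsE)
  have w: "lookup w j \<le> \<alpha> t - 1" if j: "j \<in> {1..i t}" for j
  proof (rule ccontr)
    assume "\<not> lookup w j \<le> \<alpha> t - 1"
    then have le: "\<alpha> t \<le> lookup w j" by simp
    let ?c = "c(t := j)"
    have "w = single j (\<alpha> t) + (w - single j (\<alpha> t))"
      using le by (intro poly_mapping_eqI) (auto simp: lookup_add lookup_minus lookup_single when_def)
    moreover have "(\<Sum>q = 1..t. single (?c q) (\<alpha> q)) = (\<Sum>q = 1..t - 1. single (c q) (\<alpha> q)) + single j (\<alpha> t)"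
    proof -
      have "(\<Sum>q = 1..t. single (?c q) (\<alpha> q)) = single j (\<alpha> t) + (\<Sum>q = 1..<t. single (?c q) (\<alpha> q))"
        using t by (simp add: sum.last_plus)
      also have "(\<Sum>q = 1..<t. single (?c q) (\<alpha> q)) = (\<Sum>q = 1..t - 1. single (c q) (\<alpha> q))"
        using t by (intro sum.cong) auto
      finally show ?thesis by (simp add: add.commute)
    qed
    ultimately have "v = (\<Sum>q = 1..t. single (?c q) (\<alpha> q)) + (w - single j (\<alpha> t))"
      using c(3) by (simp add: add.assoc)
    moreover have "\<forall>q\<in>{1..t}. ?c q \<in> {1..i q}" using c(1) j by auto
    ultimately have "v \<in> prod_mons t"
      using prod_monsI[of t ?c "w - single j (\<alpha> t)"] monoms_diff[OF c(2)] by simp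
    then show False using v(2) by simp
  qed
  have "keys w \<subseteq> {1..i t}" using v(3) unfolding c(3) keys_add_nat by simp
  then have "monom_deg w = (\<Sum>j\<in>{1..i t}. lookup w j)" by (intro monom_deg_eq_sum) simp_all
  also have "\<dots> \<le> (\<Sum>j\<in>{1..i t}. \<alpha> t - 1)" using w by (intro sum_mono) blast
  finally have "monom_deg w \<le> (\<alpha> t - 1) * i t" by (simp add: mult.commute)
  moreover have "{1..t - 1} = {1..<t}" using t by auto
  then have "monom_deg (\<Sum>q = 1..t - 1. single (c q) (\<alpha> q)) = (\<Sum>s = 1..<t. \<alpha> s)"
    by (simp add: monom_deg_sum)
  ultimately show ?thesis by (simp add: c(3) \<chi>_def monom_deg_add)
qed

text \<open>Taking the least index from s on at which v is missing produces the adjacent pair t - 1,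
  t that the degree bound requires.\<close>

lemma exit_index:
  assumes "v \<in> prod_mons s" "v \<notin> prod_mons r" "s \<le> r"
  obtains t where "s < t" "t \<le> r" "v \<in> prod_mons (t - 1)" "v \<notin> prod_mons t"
proof -
  define t where "t = (LEAST t. s \<le> t \<and> v \<notin> prod_mons t)"
  have t: "s \<le> t \<and> v \<notin> prod_mons t" unfolding t_def by (rule LeastI[of _ r]) (use assms in simp)
  have "t \<le> r" unfolding t_def by (rule Least_le) (use assms in simp)
  moreover have "t \<noteq> s" using t assms(1) by blast
  moreover have "v \<in> prod_mons (t - 1)"
  proof (rule ccontr)
    assume "v \<notin> prod_mons (t - 1)"
    then have "t \<le> t - 1" unfolding t_def
      by (intro Least_le) (use t \<open>t \<noteq> s\<close> in \<open>auto simp: t_def[symmetric]\<close>)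
    then show False using t \<open>t \<noteq> s\<close> by arith
  qed
  ultimately show thesis using t that[of t] by simp
qed

text \<open>Division by x_m does no harm to factors that cannot use x_m. At any later factor all
  variables of u are available, so leaving the product there would force the degree of u down to at
  most \<open>\<chi> t + 1\<close>.\<close>

lemma prod_mons_above:
  assumes u: "u \<in> prod_mons r" and deg: "\<And>q. q \<in> {1..r} \<Longrightarrow> \<chi> q + 1 < monom_deg u"
  shows "u - single (Max (keys u)) 1 \<in> prod_mons r"
proof (rule ccontr)
  define m where "m = Max (keys u)"
  let ?v = "u - single m 1"
  assume "u - single (Max (keys u)) 1 \<notin> prod_mons r"
  then have nin: "?v \<notin> prod_mons r" by (simp add: m_def)
  have "u \<noteq> 0" using deg[of 1] r by auto
  then have mu: "m \<in> keys u" unfolding m_def by (rule Max_keys_in)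
  \<comment> \<open>The index s separates the factors with i q < m from those with m <= i q. The
    first s factors use no power of x_m, so x_m divides the cofactor.\<close>
  obtain s where s: "s \<le> r" "\<And>q. q \<in> {1..s} \<Longrightarrow> i q < m" "\<And>q. q \<in> {Suc s..r} \<Longrightarrow> m \<le> i q"
  proof -
    define s where "s = (GREATEST s. s \<le> r \<and> (s = 0 \<or> i s < m))"
    have s: "s \<le> r \<and> (s = 0 \<or> i s < m)"
      unfolding s_def by (rule GreatestI_nat[of _ 0 r]) auto
    have greatest: "q \<le> s" if "q \<le> r" "i q < m" for q
      unfolding s_def by (rule Greatest_le_nat[of _ _ r]) (use that in auto)
    show thesis
    proof (rule that[of s])
      show "i q < m" if "q \<in> {1..s}" for q using that s i_le[of q s] by force
      show "m \<le> i q" if "q \<in> {Suc s..r}" for q using that greatest[of q] by force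
    qed (use s in blast)
  qed
  have "?v \<in> prod_mons s"
  proof -
    have "u \<in> prod_mons s" using u prod_mons_antimono[OF s(1)] by blast
    then obtain c w where c: "\<forall>q\<in>{1..s}. c q \<in> {1..i q}" "w \<in> monoms n"
      "u = (\<Sum>q = 1..s. single (c q) (\<alpha> q)) + w" by (rule prod_monsE)
    have "c q \<noteq> m" if "q \<in> {1..s}" for q
      using c(1) s(2)[OF that] that by fastforce
    then have "lookup (\<Sum>q = 1..s. single (c q) (\<alpha> q)) m = 0"
      by (simp add: lookup_sum lookup_single when_def)
    then have mw: "m \<in> keys w" using mu by (simp add: c(3) in_keys_iff lookup_add)
    have "?v = (\<Sum>q = 1..s. single (c q) (\<alpha> q)) + (w - single m 1)"
      using mw unfolding c(3) by (intro poly_mapping_eqI)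
        (auto simp: lookup_add lookup_minus lookup_single when_def in_keys_iff)
    then show ?thesis using prod_monsI[OF c(1) monoms_diff[OF c(2)]] by simp
  qed
  then obtain t where t: "s < t" "t \<le> r" "?v \<in> prod_mons (t - 1)" "?v \<notin> prod_mons t"
    using exit_index nin s(1) by blast
  then have tr: "t \<in> {1..r}" by simp
  have "keys u \<subseteq> {1..n}" using u prod_mons_monoms[of r] by (auto simp: monoms_def)
  then have "keys u \<subseteq> {1..m}" by (auto simp: m_def)
  then have "keys u \<subseteq> {1..i t}" using s(3)[of t] t(1,2) by fastforce
  then have "keys ?v \<subseteq> {1..i t}" using keys_diff_single[of u m] by auto
  then have "monom_deg ?v \<le> \<chi> t" by (rule deg_le_\<chi>[OF tr t(3,4)])
  then show False using deg[OF tr] monom_deg_diff_single[OF mu] by simp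
qed

text \<open>Every variable other than x_1 has exponent at most \<open>\<alpha> q - 1\<close>, too
  small for each of the first q factors since \<open>\<alpha>\<close> decreases. All q powers would
  have to be powers of x_1, whose exponent is one short of their sum.\<close>

lemma corner_notin_prod_mons:
  assumes q: "q \<in> {1..r}"
  shows "single 1 (\<Sum>s = 1..<q. \<alpha> s) + (\<Sum>j = 1..i q. single j (\<alpha> q - 1)) \<notin> prod_mons q"
    (is "?v \<notin> _")
proof
  assume "?v \<in> prod_mons q"
  then obtain c w where c: "\<forall>s\<in>{1..q}. c s \<in> {1..i s}" "w \<in> monoms n"
    "?v = (\<Sum>s = 1..q. single (c s) (\<alpha> s)) + w" by (rule prod_monsE)
  have lv: "lookup ?v j = (if j = 1 then (\<Sum>s = 1..<q. \<alpha> s) else 0) + (if j \<in> {1..i q} then \<alpha> q - 1 else 0)" for j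
    by (simp add: lookup_add lookup_sum lookup_single when_def)
  have lge: "(\<Sum>s = 1..q. if c s = j then \<alpha> s else 0) \<le> lookup ?v j" for j
    unfolding c(3) by (simp add: lookup_add lookup_sum lookup_single when_def)
  have pos: "\<alpha> q > 0" using \<alpha>_pos q by blast
  have c1: "c s = 1" if s: "s \<in> {1..q}" for s
  proof (rule ccontr)
    assume ne: "c s \<noteq> 1"
    have "\<alpha> s \<le> (\<Sum>p = 1..q. if c p = c s then \<alpha> p else 0)"
      using member_le_sum[of s "{1..q}" "\<lambda>p. if c p = c s then \<alpha> p else 0"] s by simp
    also have "\<dots> \<le> lookup ?v (c s)" by (rule lge)
    also have "\<dots> \<le> \<alpha> q - 1" using ne by (simp only: lv) simp
    finally show False using \<alpha>_le[of s q] s q pos by auto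
  qed
  have "(\<Sum>s = 1..q. \<alpha> s) = (\<Sum>s = 1..q. if c s = 1 then \<alpha> s else 0)"
    using c1 by (intro sum.cong) auto
  also have "\<dots> \<le> lookup ?v 1" by (rule lge)
  also have "\<dots> \<le> (\<Sum>s = 1..<q. \<alpha> s) + (\<alpha> q - 1)" by (simp only: lv) simp
  finally have "(\<Sum>s = 1..q. \<alpha> s) \<le> (\<Sum>s = 1..<q. \<alpha> s) + (\<alpha> q - 1)" .
  moreover have "(\<Sum>s = 1..q. \<alpha> s) = (\<Sum>s = 1..<q. \<alpha> s) + \<alpha> q"
    using q by (simp add: sum.last_plus add.commute)
  ultimately show False using pos by simp
qed

text \<open>The corner monomial times x_(i_q) just completes the q-th factor. If it left the product
  at a later t, its degree \<open>\<chi> q + 1\<close> would be at most \<open>\<chi> t\<close>,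
  against the maximality of \<open>\<chi> q\<close>.\<close>

lemma witness:
  assumes q: "q \<in> {1..r}" and max: "\<And>t. t \<in> {1..r} \<Longrightarrow> \<chi> t \<le> \<chi> q"
  shows "\<exists>w. w \<in> prod_mons r \<and> w \<noteq> 0 \<and> monom_deg w = \<chi> q + 1 \<and> w - single (Max (keys w)) 1 \<notin> prod_mons r"
proof -
  define v where "v = single 1 (\<Sum>s = 1..<q. \<alpha> s) + (\<Sum>j = 1..i q. single j (\<alpha> q - 1))"
  define w where "w = v + single (i q) 1"
  have iq: "i q \<in> {1..n}" by (rule i_mem[OF q])
  have pos: "\<alpha> q > 0" using \<alpha>_pos q by blast
  have "keys (\<Sum>j = 1..i q. single j (\<alpha> q - 1)) \<subseteq> {1..i q}"
    by (rule keys_sum_subset) auto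
  then have kv: "keys v \<subseteq> {1..i q}" using iq by (auto simp: v_def keys_add_nat split: if_splits)
  then have kw: "keys w \<subseteq> {1..i q}" using iq by (auto simp: w_def keys_add_nat)
  have "Max (keys w) = i q"
    using kv by (intro Max_eqI) (auto simp: w_def keys_add_nat)
  then have "w - single (Max (keys w)) 1 = v" by (simp add: w_def)
  moreover have "v \<notin> prod_mons r"
    using corner_notin_prod_mons[OF q] prod_mons_antimono[of q r] q unfolding v_def by auto
  moreover have deg: "monom_deg w = \<chi> q + 1"
    by (simp add: w_def v_def monom_deg_add monom_deg_sum \<chi>_def mult.commute)
  moreover have "w \<noteq> 0" using deg by auto
  moreover have "w \<in> prod_mons r"
  proof (rule ccontr)
    assume nin: "w \<notin> prod_mons r"
    have "w \<in> prod_mons q"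
    proof -
      \<comment> \<open>The first q - 1 factors take their powers from x_1. The q-th takes the
        corner's \<open>\<alpha> q - 1\<close> copies of x_(i_q) and the additional one; the
        remaining variables form the cofactor.\<close>
      let ?c = "\<lambda>s. if s = q then i q else 1"
      have c: "\<forall>s\<in>{1..q}. ?c s \<in> {1..i s}"
      proof
        fix s assume "s \<in> {1..q}"
        then have "i s \<in> {1..n}" using q by (intro i_mem) auto
        then show "?c s \<in> {1..i s}" by auto
      qed
      let ?w = "\<Sum>j = 1..<i q. single j (\<alpha> q - 1)"
      have "keys ?w \<subseteq> {1..n}" using iq by (intro keys_sum_subset) auto
      then have w: "?w \<in> monoms n" by (simp add: monoms_def)
      have "(\<Sum>s = 1..q. single (?c s) (\<alpha> s)) = (\<Sum>s = 1..<q. single (?c s) (\<alpha> s)) + single (i q) (\<alpha> q)"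
        using q by (simp add: sum.last_plus add.commute)
      also have "(\<Sum>s = 1..<q. single (?c s) (\<alpha> s)) = (\<Sum>s = 1..<q. single 1 (\<alpha> s))"
        by (intro sum.cong) auto
      also have "\<dots> = single 1 (\<Sum>s = 1..<q. \<alpha> s)"
        by (intro poly_mapping_eqI) (simp add: lookup_sum lookup_single when_def)
      finally have *: "(\<Sum>s = 1..q. single (?c s) (\<alpha> s)) = single 1 (\<Sum>s = 1..<q. \<alpha> s) + single (i q) (\<alpha> q)" .
      have "(\<Sum>j = 1..i q. single j (\<alpha> q - 1)) = ?w + single (i q) (\<alpha> q - 1)"
        using iq by (simp add: sum.last_plus add.commute)
      moreover have "single (i q) (\<alpha> q) = single (i q) (\<alpha> q - 1) + single (i q) 1"
        using pos by (simp add: single_add[symmetric])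
      ultimately have "w = (\<Sum>s = 1..q. single (?c s) (\<alpha> s)) + ?w"
        unfolding * w_def v_def by (simp add: ac_simps)
      then show ?thesis using prod_monsI[OF c w] by simp
    qed
    then obtain t where t: "q < t" "t \<le> r" "w \<in> prod_mons (t - 1)" "w \<notin> prod_mons t"
      using exit_index[OF _ nin] q by auto
    have tr: "t \<in> {1..r}" using t by simp
    have "keys w \<subseteq> {1..i t}" using kw i_less[OF q tr t(1)] by fastforce
    from deg_le_\<chi>[OF tr t(3,4) this] max[OF tr] show False by (simp add: deg)
  qed
  ultimately show ?thesis by (intro exI[of _ w]) simp
qed

lemma reg_principal_SBT:
  "reg n (principal_SBT n (\<Sum>q = 1..r. single (i q) (\<alpha> q)) :: 'k::field mpoly set) =
    int (Max (\<chi> ` {1..r})) + 1"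
proof -
  have "Max (\<chi> ` {1..r}) \<in> \<chi> ` {1..r}" using r by (intro Max_in) auto
  then obtain q where q: "q \<in> {1..r}" "\<chi> q = Max (\<chi> ` {1..r})" by auto
  have max: "\<chi> t \<le> \<chi> q" if "t \<in> {1..r}" for t using that unfolding q(2) by simp
  obtain w where w: "w \<in> prod_mons r" "w \<noteq> 0" "monom_deg w = \<chi> q + 1"
    "w - single (Max (keys w)) 1 \<notin> prod_mons r"
    using witness[OF q(1) max] by blast
  have "reg n {f :: 'k mpoly. keys f \<subseteq> prod_mons r} = int (\<chi> q + 1)"
  proof (rule reg_monomial_ideal[OF _ _ _ w])
    show "prod_mons r \<subseteq> monoms n" by (rule prod_mons_monoms) simp
    show "u + v \<in> prod_mons r" if "u \<in> prod_mons r" "v \<in> monoms n" for u v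
      using that unfolding prod_mons_def by (rule up_set_add)
    show "u - single (Max (keys u)) 1 \<in> prod_mons r"
      if "u \<in> prod_mons r" "\<chi> q + 1 < monom_deg u" for u
      using that(1) by (rule prod_mons_above) (use that(2) max in force)
  qed
  then show ?thesis unfolding principal_SBT_eq q(2) by simp
qed

end

theorem theorem1p3p6:
  fixes n r :: nat and i \<alpha> :: "nat \<Rightarrow> nat" and u :: monom
  assumes "infinite (UNIV :: 'k::field set)"
    and "n \<ge> 2"
    and "r \<ge> 1"
    and "i ` {1..r} \<subseteq> {1..n}"
    and "strict_mono_on {1..r} i"
    and "\<forall>q \<in> {1..r}. \<alpha> q > 0"
    and "antimono_on {1..r} \<alpha>"
    and "u = (\<Sum>q = 1..r. Poly_Mapping.single (i q) (\<alpha> q))"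
  shows "reg n (principal_SBT n u :: 'k mpoly set) =
    int (Max ((\<lambda>q. (\<Sum>s = 1..<q. \<alpha> s) + (\<alpha> q - 1) * i q) ` {1..r})) + 1"
proof -
  interpret sbt_exponents n r i \<alpha> using assms(3-7) by unfold_locales
  show ?thesis using reg_principal_SBT unfolding assms(8) \<chi>_def by simp
qed

end
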